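(* Let $y(x;\sigma,J,\theta_1,\theta_2,\theta_3,\theta_\infty)$ be a generic solution of the Painlevé VI equation with $\sigma,J\ne0$, and let $\Phi(u;\Phi_0)$ be the corresponding solution of the $3\times3$ isomonodromy equation, with boundary value $\Phi_0$. Set $\varphi_{ij}=(\Phi_0)_{ij}$. Then $$\theta_i=-\varphi_{ii},\quad i=1,2,3,$$ $$\sigma^2=(\varphi_{11}-\varphi_{22})^2+4\varphi_{12}\varphi_{21},$$ $$\theta_\infty^2=4(\varphi_{12}\varphi_{21}+\varphi_{23}\varphi_{32}+\varphi_{31}\varphi_{13})+\theta_1^2+\theta_2^2+\theta_3^2-2(\theta_1\theta_2+\theta_2\theta_3+\theta_1\theta_3),$$ $$(\theta_\infty+\theta_3-\sigma)(\theta_\infty-\theta_3-\sigma)J=(\varphi_{13}\varphi_{31}-\varphi_{32}\varphi_{23})+\frac{(\varphi_{22}-\varphi_{11})(2\varphi_{33}-\varphi_{11}-\varphi_{22})}{4}+\frac2\sigma(\varphi_{13}\varphi_{32}\varphi_{21}-\varphi_{23}\varphi_{31}\varphi_{12})+\frac{(\theta_1^2-\theta_2^2)(\theta_3^2-\theta_\infty^2)}{4\sigma^2}.$$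
   Context: **Painlevé VI.** With parameters $\theta_1,\theta_2,\theta_3,\theta_\infty\in\mathbb{C}$, PVI is $$\frac{d^2y}{dx^2}=\frac12\Big[\frac1y+\frac1{y-1}+\frac1{y-x}\Big]\Big(\frac{dy}{dx}\Big)^2-\Big[\frac1x+\frac1{x-1}+\frac1{y-x}\Big]\frac{dy}{dx}+\frac{y(y-1)(y-x)}{x^2(x-1)^2}\Big[\frac{(\theta_\infty-1)^2}{2}-\frac{\theta_1^2}{2}\frac{x}{y^2}+\frac{\theta_3^2}{2}\frac{x-1}{(y-1)^2}+\frac{1-\theta_2^2}{2}\frac{x(x-1)}{(y-x)^2}\Big].$$ $y(x;\sigma,J,\theta_1,\theta_2,\theta_3,\theta_\infty)$ denotes a generic solution, i.e. one with the following behaviour as $x\to0$ (on a fixed branch of $\log x$), where $0\le\mathrm{Re}(\sigma)<1$: $y(x)\sim Jx^{1-\sigma}(1+O(x^\epsilon))$ for some small $\epsilon>0$ if $\mathrm{Re}(\sigma)>0$; $y(x)\sim Jx^{1-\sigma}+J_1x^{1+\sigma}+J_2x+O(x^{2-\sigma})$ if $\mathrm{Re}(\sigma)=0$, $\sigma\ne0$, with $J_1=\frac{(\sigma^2-(\theta_1-\theta_2)^2)(\sigma^2-(\theta_1+\theta_2)^2)}{16\sigma^4J}$, $J_2=\frac{\theta_1^2-\theta_2^2+\sigma^2}{2\sigma^2}$. **Isomonodromy equation ($n=3$).** For $\Phi(u)=(\phi_{ij}(u))$, a $3\times3$ matrix function of $u=(u_1,u_2,u_3)$ with distinct $u_i$: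 $\partial_{u_k}\phi_{kk}=0$; $\ \partial_{u_k}\phi_{ij}=\big(\frac1{u_k-u_j}-\frac1{u_k-u_i}\big)\phi_{ik}\phi_{kj}$ for $i,j\ne k$; $\ \partial_{u_k}\phi_{ik}=\sum_{j\ne k}\frac{\delta_{ij}\phi_{kk}-\phi_{ij}}{u_k-u_j}\phi_{jk}$ for $i\neq k$; $\ \partial_{u_k}\phi_{kj}=\sum_{i\ne k}\phi_{ki}\frac{\phi_{ij}-\delta_{ij}\phi_{kk}}{u_k-u_i}$ for $j\ne k$. Let $\delta\Phi$ be the (constant) diagonal part of $\Phi$, and for a matrix $A$ let $\delta_kA$ be the matrix with $(\delta_kA)_{ij}=A_{ij}$ if $1\le i,j\le k$ or $i=j$, and $0$ otherwise. **Boundary value.** Almost every (``generic'') solution $\Phi=\Phi_3$ has a boundary value: there are a matrix function $\Phi_2(u_1,u_2)$ and a constant matrix $\Phi_0$ with $\lim_{u_3\to\infty}\delta_2\Phi=\delta_2\Phi_2$, $\ \lim_{u_3\to\infty}\big(\frac{u_3-u_2}{u_2-u_1}\big)^{\delta_2\Phi_2}\Phi\big(\frac{u_3-u_2}{u_2-u_1}\big)^{-\delta_2\Phi_2}=\Phi_2$, $\ (u_2-u_1)^{\delta_1\Phi_0}\Phi_2(u_2-u_1)^{-\delta_1\Phi_0}=\Phi_0$ (so $\delta_1\Phi_0=\delta\Phi$), and the eigenvalues of the upper left $2\times2$ submatrix of $\Phi_0$ satisfy $|\mathrm{Re}(\lambda_1^{(2)}-\lambda_2^{(2)})|<1$. $\Phi_0$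 determines $\Phi$, which is written $\Phi(u;\Phi_0)$. **Correspondence.** Consider solutions $\Phi$ with $\delta\Phi=-\mathrm{diag}(\theta_1,\theta_2,\theta_3)$ and distinct eigenvalues $0,\ \frac{\theta_\infty-\theta_1-\theta_2-\theta_3}2,\ \frac{-\theta_\infty-\theta_1-\theta_2-\theta_3}2$. These, up to conjugation by constant matrices $\mathrm{diag}(k_1^0,k_2^0,1)$, correspond one-to-one to PVI solutions $y(x)$ as follows. Put $x=\frac{u_2-u_1}{u_3-u_1}$, $\Omega(x)=(u_3-u_1)^{\delta\Phi}\Phi(u)(u_3-u_1)^{-\delta\Phi}$ and $$f(\theta_1,\theta_2,\theta_3,\theta_\infty;x,y)=(x-x^2)\tfrac{dy}{dx}+(1-\theta_\infty)y^2+[(\theta_2+\theta_\infty)x+\theta_1-\theta_2-1]y-\theta_1x .$$ Then $\Omega_{12}=\frac{k_1}{k_2}\frac{f(\theta_1,\theta_2,\theta_3,\theta_\infty;x,y)}{2(1-x)y}$, $\ \Omega_{21}=\frac{k_2}{k_1}\frac{f(-\theta_1,-\theta_2,\theta_3,\theta_\infty;x,y)}{2(y-x)}$, $\Omega_{13}=k_1\frac{f(\theta_1,\theta_1-\theta_3-\theta_\infty,\theta_3,\theta_\infty;x,y)}{2(x-1)y}$, $\ \Omega_{31}=\frac1{k_1}\frac{f(-\theta_1,-\theta_1+\theta_3-\theta_\infty,\theta_3,\theta_\infty;x,y)}{2x(y-1)}$, $\Omega_{23}=k_2\frac{f(-\theta_2+\theta_3+\theta_\infty,-\theta_2,\theta_3,\theta_\infty;x,y)}{2(x-y)}$,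 $\ \Omega_{32}=\frac1{k_2}\frac{f(\theta_2-\theta_3+\theta_\infty,\theta_2,\theta_3,\theta_\infty;x,y)}{2x(1-y)}$, where $k_i(x)=k_i^0\exp\big(\int^xl_i(\xi)d\xi\big)$, $k_i^0\in\mathbb{C}\setminus\{0\}$, $l_1=\frac{f(\theta_1,\theta_2,\theta_3,\theta_1+\theta_3-\theta_2;x,y)}{2x(1-x)(1-y)y}$, $\ l_2=\frac{f(-\theta_1,-\theta_2,\theta_3,\theta_3+\theta_2-\theta_1;x,y)}{2x(y-1)(x-y)}+\frac{\theta_2-\theta_3}{x-1}$. The ``corresponding'' solution $\Phi$ is any member of the class attached to $y$. *)

theory Defs
  imports "HOL-Analysis.Analysis" "HOL-Library.Landau_Symbols"
begin

section \<open>Branches of the logarithm\<close>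

text \<open>The branch of the logarithm centred at the direction \<open>a\<close>: its imaginary part lies in
  \<open>{a - pi<..a + pi}\<close>. Here \<open>a\<close> is any real number, so all sheets are covered.\<close>

definition branch_log :: "real \<Rightarrow> complex \<Rightarrow> complex" where
  "branch_log a z = Ln (z * cis (- a)) + \<i> * of_real a"

definition branch_pow :: "real \<Rightarrow> complex \<Rightarrow> complex \<Rightarrow> complex" where
  "branch_pow a z c = exp (c * branch_log a z)"

text \<open>An open sector of half-opening \<open>w\<close> (\<open>w = pi\<close> is the plane cut opposite to the direction \<open>a\<close>),
  and its intersection with a disc centred at the origin.\<close>

definition sector :: "real \<Rightarrow> real \<Rightarrow> complex set" where
  "sector a w = {z. z \<noteq> 0 \<and> \<bar>Im (branch_log a z) - a\<bar> < w}"

definition sector_at_0 :: "real \<Rightarrow> real \<Rightarrow> real \<Rightarrow> complex set" where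
  "sector_at_0 a w r = {z \<in> sector a w. cmod z < r}"


section \<open>Painleve VI\<close>

definition PVI_rhs ::
  "complex \<Rightarrow> complex \<Rightarrow> complex \<Rightarrow> complex \<Rightarrow> complex \<Rightarrow> complex \<Rightarrow> complex \<Rightarrow> complex" where
  "PVI_rhs t1 t2 t3 tinf x y y' =
     1/2 * (1/y + 1/(y - 1) + 1/(y - x)) * y'^2
     - (1/x + 1/(x - 1) + 1/(y - x)) * y'
     + y * (y - 1) * (y - x) / (x^2 * (x - 1)^2) *
       ((tinf - 1)^2/2 - t1^2/2 * (x / y^2) + t3^2/2 * ((x - 1) / (y - 1)^2)
         + (1 - t2^2)/2 * (x * (x - 1) / (y - x)^2))"

text \<open>The points at which both sides of PVI, and the formulas of the correspondence below, make
  sense. A solution may take the values 0, 1 and \<open>x\<close> at isolated points (for \<open>Re \<sigma> = 0\<close> such points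
  can accumulate at \<open>x = 0\<close>); the last condition excludes the functions that are identically 0, 1
  or \<open>x\<close>, which are not solutions.\<close>

definition regular_points :: "complex set \<Rightarrow> (complex \<Rightarrow> complex) \<Rightarrow> complex set" where
  "regular_points D y = {x \<in> D. y x \<noteq> 0 \<and> y x \<noteq> 1 \<and> y x \<noteq> x}"

definition PVI_solution ::
  "complex \<Rightarrow> complex \<Rightarrow> complex \<Rightarrow> complex \<Rightarrow> complex set \<Rightarrow> (complex \<Rightarrow> complex) \<Rightarrow> bool" where
  "PVI_solution t1 t2 t3 tinf D y \<longleftrightarrow>
     y holomorphic_on D \<and>
     (\<forall>x \<in> regular_points D y. deriv (deriv y) x = PVI_rhs t1 t2 t3 tinf x (y x) (deriv y x)) \<and>
     regular_points D y \<noteq> {}"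

definition J1_coeff :: "complex \<Rightarrow> complex \<Rightarrow> complex \<Rightarrow> complex \<Rightarrow> complex" where
  "J1_coeff \<sigma> J t1 t2 = (\<sigma>^2 - (t1 - t2)^2) * (\<sigma>^2 - (t1 + t2)^2) / (16 * \<sigma>^4 * J)"

definition J2_coeff :: "complex \<Rightarrow> complex \<Rightarrow> complex \<Rightarrow> complex" where
  "J2_coeff \<sigma> t1 t2 = (t1^2 - t2^2 + \<sigma>^2) / (2 * \<sigma>^2)"

definition generic_behaviour ::
  "complex \<Rightarrow> complex \<Rightarrow> complex \<Rightarrow> complex \<Rightarrow> real \<Rightarrow> complex set \<Rightarrow> (complex \<Rightarrow> complex) \<Rightarrow> bool" where
  "generic_behaviour \<sigma> J t1 t2 a D y \<longleftrightarrow>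
     0 \<le> Re \<sigma> \<and> Re \<sigma> < 1 \<and>
     (if Re \<sigma> > 0 then
        \<exists>h \<epsilon>. \<epsilon> > 0 \<and> h \<in> O[at 0 within D](\<lambda>x. of_real (cmod x powr \<epsilon>)) \<and>
              (\<forall>x\<in>D. y x = J * branch_pow a x (1 - \<sigma>) * (1 + h x))
      else
        \<sigma> \<noteq> 0 \<and>
        (\<lambda>x. y x - (J * branch_pow a x (1 - \<sigma>) + J1_coeff \<sigma> J t1 t2 * branch_pow a x (1 + \<sigma>)
                    + J2_coeff \<sigma> t1 t2 * x))
          \<in> O[at 0 within D](\<lambda>x. branch_pow a x (2 - \<sigma>)))"

definition generic_PVI_solution ::
  "complex \<Rightarrow> complex \<Rightarrow> complex \<Rightarrow> complex \<Rightarrow> complex \<Rightarrow> complex \<Rightarrow> real \<Rightarrow> complex set \<Rightarrow>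
     (complex \<Rightarrow> complex) \<Rightarrow> bool" where
  "generic_PVI_solution \<sigma> J t1 t2 t3 tinf a D y \<longleftrightarrow>
     PVI_solution t1 t2 t3 tinf D y \<and> generic_behaviour \<sigma> J t1 t2 a D y"


section \<open>Matrices\<close>

definition mexp :: "complex^'n^'n \<Rightarrow> complex^'n^'n" where
  "mexp A = (\<Sum>n. (1 / fact n) *\<^sub>R ((\<lambda>B. A ** B) ^^ n) (mat 1))"

text \<open>\<open>conj_pow l A B\<close> is \<open>z\<^sup>A B z\<^sup>-\<^sup>A\<close> for \<open>l\<close> the chosen value of the logarithm of \<open>z\<close>.\<close>

definition conj_pow :: "complex \<Rightarrow> complex^'n^'n \<Rightarrow> complex^'n^'n \<Rightarrow> complex^'n^'n" where
  "conj_pow l A B = mexp (mat l ** A) ** B ** mexp (- (mat l ** A))"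

definition eigenvals :: "complex^'n^'n \<Rightarrow> complex set" where
  "eigenvals A = {c. \<exists>v. v \<noteq> 0 \<and> A *v v = c *s v}"

definition diag_part :: "complex^'n^'n \<Rightarrow> complex^'n^'n" where
  "diag_part A = (\<chi> i j. if i = j then A$i$j else 0)"

definition diag3 :: "complex \<Rightarrow> complex \<Rightarrow> complex \<Rightarrow> complex^3^3" where
  "diag3 a b c = (\<chi> i j. if i = j then (if i = 1 then a else if i = 2 then b else c) else 0)"

text \<open>The numeral 3 of type \<open>3\<close> equals 0, so the order of that type is not the order 1, 2, 3 of the
  indices.\<close>

definition idx :: "3 \<Rightarrow> nat" where
  "idx i = (if i = 1 then 1 else if i = 2 then 2 else 3)"

definition delta_part :: "nat \<Rightarrow> complex^3^3 \<Rightarrow> complex^3^3" where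
  "delta_part k A = (\<chi> i j. if (idx i \<le> k \<and> idx j \<le> k) \<or> i = j then A$i$j else 0)"

definition upper_left_2 :: "complex^3^3 \<Rightarrow> complex^2^2" where
  "upper_left_2 A = (\<chi> i j. A $ (if i = 1 then 1 else 2) $ (if j = 1 then 1 else 2))"


section \<open>The isomonodromy equation\<close>

definition has_partial ::
  "(complex^3 \<Rightarrow> complex) \<Rightarrow> complex \<Rightarrow> 3 \<Rightarrow> complex^3 \<Rightarrow> bool" where
  "has_partial F d k u \<longleftrightarrow>
     ((\<lambda>t. F (\<chi> i. if i = k then t else u$i)) has_field_derivative d) (at (u$k))"

text \<open>The system is stated for both signs \<open>s = 1\<close>, \<open>s = -1\<close> of the equation for the entries outside
  row and column \<open>k\<close>. The sign \<open>s = 1\<close> is the one in the usual display of the system with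
  right-hand side \<open>(1/(u\<^sub>k - u\<^sub>j) - 1/(u\<^sub>k - u\<^sub>i)) \<phi>\<^sub>i\<^sub>k \<phi>\<^sub>k\<^sub>j\<close>. With the signs of the other two families
  of equations as below, it is \<open>s = -1\<close> that makes the system a Lax equation
  \<open>\<partial>\<^sub>k \<Phi> = [B\<^sub>k, \<Phi>]\<close>, where \<open>B\<^sub>k\<close> has entries \<open>\<phi>\<^sub>i\<^sub>k/(u\<^sub>k - u\<^sub>i)\<close> in column \<open>k\<close>,
  \<open>\<phi>\<^sub>k\<^sub>j/(u\<^sub>k - u\<^sub>j)\<close> in row \<open>k\<close> and 0 elsewhere, so that the eigenvalues of \<open>\<Phi>\<close> are constant.\<close>

definition isomonodromy_solution ::
  "complex \<Rightarrow> (complex^3) set \<Rightarrow> (complex^3 \<Rightarrow> complex^3^3) \<Rightarrow> bool" where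
  "isomonodromy_solution s U \<Phi> \<longleftrightarrow>
     continuous_on U \<Phi> \<and>
     (\<forall>u\<in>U. \<forall>k.
        has_partial (\<lambda>u. \<Phi> u $ k $ k) 0 k u \<and>
        (\<forall>i j. i \<noteq> k \<longrightarrow> j \<noteq> k \<longrightarrow>
           has_partial (\<lambda>u. \<Phi> u $ i $ j)
             (s * (1 / (u$k - u$j) - 1 / (u$k - u$i)) * \<Phi> u $ i $ k * \<Phi> u $ k $ j) k u) \<and>
        (\<forall>i. i \<noteq> k \<longrightarrow>
           has_partial (\<lambda>u. \<Phi> u $ i $ k)
             (\<Sum>j\<in>UNIV - {k}. ((if i = j then \<Phi> u $ k $ k else 0) - \<Phi> u $ i $ j)
                                / (u$k - u$j) * \<Phi> u $ j $ k) k u) \<and>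
        (\<forall>j. j \<noteq> k \<longrightarrow>
           has_partial (\<lambda>u. \<Phi> u $ k $ j)
             (\<Sum>i\<in>UNIV - {k}. \<Phi> u $ k $ i *
                 ((\<Phi> u $ i $ j - (if i = j then \<Phi> u $ k $ k else 0)) / (u$k - u$i))) k u))"

text \<open>\<open>\<Phi>\<close> is multivalued on the space of triples of distinct points. It is considered on the domain
  where \<open>x = (u\<^sub>2 - u\<^sub>1)/(u\<^sub>3 - u\<^sub>1)\<close> lies in the domain \<open>D\<close> of \<open>y\<close> and \<open>u\<^sub>2 - u\<^sub>1\<close> lies in a sector
  \<open>G\<close>.\<close>

definition xvar :: "complex^3 \<Rightarrow> complex" where
  "xvar u = (u$2 - u$1) / (u$3 - u$1)"

definition config_domain :: "complex set \<Rightarrow> complex set \<Rightarrow> (complex^3) set" where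
  "config_domain G D =
     {u. u$1 \<noteq> u$2 \<and> u$1 \<noteq> u$3 \<and> u$2 \<noteq> u$3 \<and> u$2 - u$1 \<in> G \<and> xvar u \<in> D}"

text \<open>The branches of the logarithms of \<open>u\<^sub>3 - u\<^sub>1 = (u\<^sub>2 - u\<^sub>1)/x\<close> and
  \<open>(u\<^sub>3 - u\<^sub>2)/(u\<^sub>2 - u\<^sub>1) = (1 - x)/x\<close> determined by the branch \<open>branch_log a\<close> of \<open>log x\<close> used for \<open>y\<close>
  and a branch \<open>branch_log b\<close> of \<open>log (u\<^sub>2 - u\<^sub>1)\<close>; \<open>log (1 - x)\<close> is the branch that tends to 0.
  This compatibility is needed: another branch for the second quotient changes \<open>\<Phi>\<^sub>0\<close>, while \<open>J\<close>
  depends on the branch of \<open>log x\<close>.\<close>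

definition log_u31 :: "real \<Rightarrow> real \<Rightarrow> complex^3 \<Rightarrow> complex" where
  "log_u31 a b u = branch_log b (u$2 - u$1) - branch_log a (xvar u)"

definition log_ratio :: "real \<Rightarrow> complex^3 \<Rightarrow> complex" where
  "log_ratio a u = Ln (1 - xvar u) - branch_log a (xvar u)"


section \<open>Boundary value\<close>

definition u3_to_inf ::
  "complex set \<Rightarrow> complex set \<Rightarrow> complex \<Rightarrow> complex \<Rightarrow> complex filter" where
  "u3_to_inf G D u1 u2 =
     inf at_infinity (principal {u3. vector [u1, u2, u3] \<in> config_domain G D})"

definition is_boundary_value ::
  "real \<Rightarrow> real \<Rightarrow> complex set \<Rightarrow> complex set \<Rightarrow> (complex^3 \<Rightarrow> complex^3^3) \<Rightarrow> complex^3^3 \<Rightarrow> bool" where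
  "is_boundary_value a b G D \<Phi> \<Phi>0 \<longleftrightarrow>
     (\<exists>\<Phi>2 :: complex \<Rightarrow> complex \<Rightarrow> complex^3^3.
        \<forall>u1 u2. u2 - u1 \<in> G \<longrightarrow>
          ((\<lambda>u3. delta_part 2 (\<Phi> (vector [u1, u2, u3]))) \<longlongrightarrow> delta_part 2 (\<Phi>2 u1 u2))
            (u3_to_inf G D u1 u2) \<and>
          ((\<lambda>u3. conj_pow (log_ratio a (vector [u1, u2, u3])) (delta_part 2 (\<Phi>2 u1 u2))
                   (\<Phi> (vector [u1, u2, u3]))) \<longlongrightarrow> \<Phi>2 u1 u2)
            (u3_to_inf G D u1 u2) \<and>
          conj_pow (branch_log b (u2 - u1)) (delta_part 1 \<Phi>0) (\<Phi>2 u1 u2) = \<Phi>0) \<and>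
     (\<forall>c1 \<in> eigenvals (upper_left_2 \<Phi>0). \<forall>c2 \<in> eigenvals (upper_left_2 \<Phi>0).
        \<bar>Re (c1 - c2)\<bar> < 1)"


section \<open>The correspondence\<close>

definition f_PVI ::
  "complex \<Rightarrow> complex \<Rightarrow> complex \<Rightarrow> complex \<Rightarrow> complex \<Rightarrow> (complex \<Rightarrow> complex) \<Rightarrow> complex" where
  "f_PVI t1 t2 t3 tinf x y =
     (x - x^2) * deriv y x + (1 - tinf) * (y x)^2
     + ((t2 + tinf) * x + t1 - t2 - 1) * y x - t1 * x"

definition l1_PVI ::
  "complex \<Rightarrow> complex \<Rightarrow> complex \<Rightarrow> (complex \<Rightarrow> complex) \<Rightarrow> complex \<Rightarrow> complex" where
  "l1_PVI t1 t2 t3 y x =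
     f_PVI t1 t2 t3 (t1 + t3 - t2) x y / (2 * x * (1 - x) * (1 - y x) * y x)"

definition l2_PVI ::
  "complex \<Rightarrow> complex \<Rightarrow> complex \<Rightarrow> (complex \<Rightarrow> complex) \<Rightarrow> complex \<Rightarrow> complex" where
  "l2_PVI t1 t2 t3 y x =
     f_PVI (- t1) (- t2) t3 (t3 + t2 - t1) x y / (2 * x * (y x - 1) * (x - y x))
     + (t2 - t3) / (x - 1)"

text \<open>\<open>k\<close> is of the form \<open>k\<^sup>0 exp(\<integral>\<^sup>x l)\<close> on \<open>S\<close> with \<open>k\<^sup>0 \<noteq> 0\<close>. The indefinite integral itself may be
  multivalued on \<open>S\<close>, because \<open>S\<close> omits the zeros of \<open>y\<close> and \<open>y - x\<close>.\<close>

definition exp_integral :: "complex set \<Rightarrow> (complex \<Rightarrow> complex) \<Rightarrow> (complex \<Rightarrow> complex) \<Rightarrow> bool" where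
  "exp_integral S l k \<longleftrightarrow>
     (\<forall>x\<in>S. k x \<noteq> 0 \<and> (k has_field_derivative l x * k x) (at x))"

definition in_PVI_class ::
  "complex \<Rightarrow> complex \<Rightarrow> complex \<Rightarrow> complex \<Rightarrow> (complex^3) set \<Rightarrow> (complex^3 \<Rightarrow> complex^3^3) \<Rightarrow> bool" where
  "in_PVI_class t1 t2 t3 tinf U \<Phi> \<longleftrightarrow>
     distinct [0, (tinf - t1 - t2 - t3) / 2, (- tinf - t1 - t2 - t3) / 2] \<and>
     (\<forall>u\<in>U. diag_part (\<Phi> u) = - diag3 t1 t2 t3 \<and>
            eigenvals (\<Phi> u) = {0, (tinf - t1 - t2 - t3) / 2, (- tinf - t1 - t2 - t3) / 2})"

text \<open>The constants \<open>k\<^sub>1\<^sup>0\<close>, \<open>k\<^sub>2\<^sup>0\<close> are arbitrary, so this describes all members of the class of \<open>\<Phi>\<close>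
  modulo conjugation by \<open>diag(k\<^sub>1\<^sup>0, k\<^sub>2\<^sup>0, 1)\<close>.\<close>

definition corresponds ::
  "complex \<Rightarrow> complex \<Rightarrow> complex \<Rightarrow> complex \<Rightarrow> real \<Rightarrow> real \<Rightarrow> complex set \<Rightarrow> complex set \<Rightarrow>
     (complex \<Rightarrow> complex) \<Rightarrow> (complex^3 \<Rightarrow> complex^3^3) \<Rightarrow> bool" where
  "corresponds t1 t2 t3 tinf a b G D y \<Phi> \<longleftrightarrow>
     (\<exists>k1 k2.
        exp_integral (regular_points D y) (l1_PVI t1 t2 t3 y) k1 \<and>
        exp_integral (regular_points D y) (l2_PVI t1 t2 t3 y) k2 \<and>
        (\<forall>u \<in> config_domain G D. xvar u \<in> regular_points D y \<longrightarrow>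
           (let x = xvar u; \<Omega> = conj_pow (log_u31 a b u) (diag_part (\<Phi> u)) (\<Phi> u) in
              \<Omega>$1$2 = k1 x / k2 x * (f_PVI t1 t2 t3 tinf x y / (2 * (1 - x) * y x)) \<and>
              \<Omega>$2$1 = k2 x / k1 x * (f_PVI (- t1) (- t2) t3 tinf x y / (2 * (y x - x))) \<and>
              \<Omega>$1$3 = k1 x * (f_PVI t1 (t1 - t3 - tinf) t3 tinf x y / (2 * (x - 1) * y x)) \<and>
              \<Omega>$3$1 = 1 / k1 x *
                 (f_PVI (- t1) (- t1 + t3 - tinf) t3 tinf x y / (2 * x * (y x - 1))) \<and>
              \<Omega>$2$3 = k2 x * (f_PVI (- t2 + t3 + tinf) (- t2) t3 tinf x y / (2 * (x - y x))) \<and>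
              \<Omega>$3$2 = 1 / k2 x *
                 (f_PVI (t2 - t3 + tinf) t2 t3 tinf x y / (2 * x * (1 - y x))))))"

end

theory Submission
  imports Defs "HOL-Complex_Analysis.Conformal_Mappings"
begin

text \<open>
  Only the diagonal entries and the cyclic products \<open>\<phi>\<^sub>i\<^sub>j \<phi>\<^sub>j\<^sub>i\<close> and \<open>\<phi>\<^sub>i\<^sub>j \<phi>\<^sub>j\<^sub>k \<phi>\<^sub>k\<^sub>i\<close> enter the four formulas.
  Conjugation by diagonal matrices does not change them, so \<open>\<Omega>\<close> may be replaced by \<open>\<Phi>\<close>, the boundary
  value \<open>\<Phi>\<^sub>0\<close> by the limit \<open>\<Phi>\<^sub>2\<close>, and the functions \<open>k\<^sub>1\<close>, \<open>k\<^sub>2\<close> drop out. What remains is to compare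
  the cyclic products of \<open>\<Phi>\<close> near \<open>x = 0\<close>, where \<open>u\<^sub>3\<close> tends to infinity, with those of \<open>\<Phi>\<^sub>2\<close>.

  \<^bold>\<open>The side of PVI.\<close> Put \<open>X = x\<^sup>\<sigma>\<close>. In the logarithmic coordinate \<open>s = log x - i a\<close> the solution
  satisfies \<open>X y/x = J + J\<^sub>2 X + J\<^sub>1 X\<^sup>2 + o(1)\<close>, uniformly on a half-strip. This covers both asymptotic
  regimes: if \<open>Re \<sigma> > 0\<close>, then \<open>X\<close> tends to 0 and only \<open>J\<close> survives. On discs of fixed radius in the
  half-strip Cauchy's inequality allows differentiation of the remainder, whence
  \<open>X (y' - y/x) = \<sigma> (J\<^sub>1 X\<^sup>2 - J) + o(1)\<close> (\<open>generic_limits\<close>). Along a sequence on which \<open>X\<close> converges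
  to some \<open>X\<^sub>0\<close> every quantity \<open>X f/x\<close> therefore converges to a polynomial in \<open>X\<^sub>0\<close>. If
  \<open>Re \<sigma> = 0\<close>, then \<open>X\<close> is periodic in \<open>log x\<close>, and \<open>X\<^sub>0\<close> can be chosen on its circle away from the
  finitely many values at which a denominator vanishes (\<open>approach_sequence\<close>).

  \<^bold>\<open>The side of the boundary value.\<close> Let \<open>A\<close> be the upper left block of \<open>\<Phi>\<^sub>2\<close>. The limit of
  \<open>\<phi>\<^sub>1\<^sub>2 \<phi>\<^sub>2\<^sub>1\<close> gives \<open>\<sigma>\<^sup>2 = (\<phi>\<^sub>1\<^sub>1 - \<phi>\<^sub>2\<^sub>2)\<^sup>2 + 4 \<phi>\<^sub>1\<^sub>2 \<phi>\<^sub>2\<^sub>1\<close>, so the eigenvalues of \<open>A\<close> differ by \<open>\<sigma>\<close> and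
  \<open>z\<^sup>A\<close> is explicit in terms of the spectral projections \<open>p\<close>, \<open>m\<close> of \<open>A\<close>. Let \<open>N\<close> be the product of the
  last column and the last row of \<open>\<Phi>\<close>. Conjugation by \<open>z\<^sup>A\<close> with \<open>z = (1 - x)/x\<close> multiplies
  \<open>m N p\<close> by \<open>z\<^sup>-\<^sup>\<sigma>\<close>, which is asymptotically \<open>X\<close>. The number \<open>2 ((m N p)\<^sub>1\<^sub>1 - (m N p)\<^sub>2\<^sub>2)\<close> is a
  combination of cyclic products, here \<open>qform\<close>; hence \<open>X qform(\<Phi>)\<close> tends to \<open>qform(\<Phi>\<^sub>2)\<close>
  (\<open>qform_limit\<close>). On the side of PVI the same limit is \<open>(\<theta>\<^sub>\<infinity> + \<theta>\<^sub>3 - \<sigma>)(\<theta>\<^sub>\<infinity> - \<theta>\<^sub>3 - \<sigma>) J\<close>, by an identity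
  between rational functions (\<open>f_PVI_products_algebra\<close>).

  Conjugation preserves the characteristic polynomial, so \<open>\<Phi>\<^sub>2\<close> has determinant 0 and the prescribed
  sum of principal 2 by 2 minors. The second fact is the formula for \<open>\<theta>\<^sub>\<infinity>\<^sup>2\<close>; together they turn
  \<open>qform(\<Phi>\<^sub>2)\<close> into the right-hand side of the formula for \<open>J\<close> (\<open>qform_J_identity\<close>).
\<close>

section \<open>Matrix exponentials and spectral resolutions\<close>

lemma mat_mult_nth: "(mat c ** (A::complex^'n^'m)) $ i $ j = c * A $ i $ j"
  by (simp add: matrix_matrix_mult_def mat_def if_distrib[of "\<lambda>x. x * _"] cong: if_cong)

lemma mult_mat_nth: "((A::complex^'n^'m) ** mat c) $ i $ j = c * A $ i $ j"
  by (simp add: matrix_matrix_mult_def mat_def if_distrib[of "\<lambda>x. _ * x"] cong: if_cong)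

lemma mat_mult_commute: "mat c ** (A::complex^'n^'n) = A ** mat c"
  by (simp add: vec_eq_iff mat_mult_nth mult_mat_nth)

lemma matrix_mult_mat_shift: "(A::complex^'n^'n) ** (mat c ** B) = mat c ** (A ** B)"
  by (simp only: matrix_mul_assoc mat_mult_commute)

lemma mat_mult_mat: "mat c ** (mat d :: complex^'n^'n) = mat (c * d)"
  by (auto simp: vec_eq_iff mat_mult_nth) (auto simp: mat_def)

lemma matrix_mult_sum_right: "(A::complex^'n^'m) ** (\<Sum>i\<in>I. B i) = (\<Sum>i\<in>I. A ** B i)"
  by (induction I rule: infinite_finite_induct) (auto simp: matrix_add_ldistrib)

lemma matrix_mult_sum_left: "(\<Sum>i\<in>I. B i) ** (A::complex^'n^'m) = (\<Sum>i\<in>I. B i ** A)"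
  by (induction I rule: infinite_finite_induct)
     (auto simp: vec_eq_iff matrix_matrix_mult_def algebra_simps sum.distrib)

lemma matrix_mult_diff_right: "(A::complex^'n^'m) ** (B - C) = A ** B - A ** C"
  by (simp add: vec_eq_iff matrix_matrix_mult_def algebra_simps sum_subtractf)

lemma matrix_mult_diff_left: "(B - C) ** (A::complex^'n^'m) = B ** A - C ** A"
  by (simp add: vec_eq_iff matrix_matrix_mult_def algebra_simps sum_subtractf)

text \<open>A resolution of the identity into eigenprojections. It makes the exponential a finite sum, which
  avoids the general theory of matrix exponentials. Projections, unlike eigenvectors, depend
  rationally on the matrix, so no off-diagonal entry has to be assumed nonzero.\<close>

definition spectral_resolution :: "complex^'n^'n \<Rightarrow> ('i::finite \<Rightarrow> complex) \<Rightarrow> ('i \<Rightarrow> complex^'n^'n) \<Rightarrow> bool" where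
  "spectral_resolution A c P \<longleftrightarrow> (\<forall>i. A ** P i = mat (c i) ** P i) \<and> (\<Sum>i\<in>UNIV. P i) = mat 1
     \<and> (\<forall>i j. P i ** P j = (if i = j then P i else 0))"

lemma mexp_spectral:
  assumes "spectral_resolution A c P"
  shows "mexp A = (\<Sum>i\<in>UNIV. mat (exp (c i)) ** P i)"
proof -
  have pow: "((\<lambda>B. A ** B) ^^ n) (mat 1) = (\<Sum>i\<in>UNIV. mat (c i ^ n) ** P i)" for n
  proof (induction n)
    case 0
    then show ?case using assms by (simp add: spectral_resolution_def)
  next
    case (Suc n)
    have "A ** (mat (c i ^ n) ** P i) = mat (c i ^ Suc n) ** P i" for i
    proof -
      have "A ** (mat (c i ^ n) ** P i) = mat (c i ^ n) ** (A ** P i)"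
        by (rule matrix_mult_mat_shift)
      also have "\<dots> = mat (c i ^ Suc n) ** P i"
        using assms by (simp add: spectral_resolution_def matrix_mul_assoc mat_mult_mat mult.commute)
      finally show ?thesis .
    qed
    then show ?case by (simp add: Suc.IH matrix_mult_sum_right)
  qed
  have sums: "(\<lambda>n. (1 / fact n) *\<^sub>R (mat (c i ^ n) ** P i)) sums (mat (exp (c i)) ** P i)" for i
  proof -
    have "bounded_linear (\<lambda>z::complex. mat z ** P i)"
      unfolding linear_conv_bounded_linear[symmetric]
      by (rule linearI) (auto simp: vec_eq_iff mat_mult_nth algebra_simps)
    from bounded_linear.sums[OF this exp_converges[of "c i"]]
    have "(\<lambda>n. mat (c i ^ n /\<^sub>R fact n) ** P i) sums (mat (exp (c i)) ** P i)" .
    moreover have "mat (c i ^ n /\<^sub>R fact n) ** P i = (1 / fact n) *\<^sub>R (mat (c i ^ n) ** P i)" for n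
      by (simp add: vec_eq_iff mat_mult_nth divide_inverse)
    ultimately show ?thesis by simp
  qed
  have "(\<lambda>n. \<Sum>i\<in>UNIV. (1 / fact n) *\<^sub>R (mat (c i ^ n) ** P i)) sums
      (\<Sum>i\<in>UNIV. mat (exp (c i)) ** P i)"
    by (rule sums_sum) (rule sums)
  then show ?thesis
    unfolding mexp_def pow scaleR_right.sum by (rule sums_unique[symmetric])
qed

lemma spectral_scale:
  assumes "spectral_resolution A c P"
  shows "spectral_resolution (mat l ** A) (\<lambda>i. l * c i) P"
proof -
  have "(mat l ** A) ** P i = mat (l * c i) ** P i" for i
  proof -
    have "(mat l ** A) ** P i = mat l ** (A ** P i)" by (simp only: matrix_mul_assoc)
    also have "\<dots> = mat (l * c i) ** P i"
      using assms by (simp add: spectral_resolution_def matrix_mul_assoc mat_mult_mat)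
    finally show ?thesis .
  qed
  then show ?thesis using assms by (simp add: spectral_resolution_def)
qed

lemma spectral_uminus:
  assumes "spectral_resolution A c P"
  shows "spectral_resolution (- A) (\<lambda>i. - c i) P"
proof -
  have "- A = mat (-1) ** A" by (simp add: vec_eq_iff mat_mult_nth)
  then show ?thesis using spectral_scale[OF assms, of "-1"] by simp
qed

lemma mexp_spectral_proj:
  assumes "spectral_resolution A c P"
  shows "P i ** mexp A = mat (exp (c i)) ** P i" "mexp A ** P i = mat (exp (c i)) ** P i"
proof -
  have idem: "P i ** P j = (if i = j then P i else 0)" for i j
    using assms by (simp add: spectral_resolution_def)
  have "P i ** (mat (exp (c j)) ** P j) = mat (exp (c j)) ** (P i ** P j)" for j
    by (rule matrix_mult_mat_shift)
  then have "P i ** mexp A = (\<Sum>j\<in>UNIV. if i = j then mat (exp (c j)) ** P j else 0)"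
    unfolding mexp_spectral[OF assms] matrix_mult_sum_right
    by (intro sum.cong refl) (simp add: idem)
  then show "P i ** mexp A = mat (exp (c i)) ** P i" by simp
  have "mexp A ** P i = (\<Sum>j\<in>UNIV. if i = j then mat (exp (c j)) ** P j else 0)"
    unfolding mexp_spectral[OF assms] matrix_mult_sum_left
    by (intro sum.cong refl) (simp add: idem matrix_mul_assoc[symmetric])
  then show "mexp A ** P i = mat (exp (c i)) ** P i" by simp
qed

text \<open>The eigenprojections of \<open>A\<close> are also those of \<open>- A\<close>, and the eigenvalues of the two exponentials
  are inverse to each other.\<close>

lemma mexp_mult_mexp_uminus:
  assumes "spectral_resolution A c P"
  shows "mexp A ** mexp (- A) = mat 1"
proof -
  have "mexp A ** mexp (- A) = (\<Sum>i\<in>UNIV. mexp A ** (mat (exp (- c i)) ** P i))"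
    by (simp add: mexp_spectral[OF spectral_uminus[OF assms]] matrix_mult_sum_right)
  also have "mexp A ** (mat (exp (- c i)) ** P i) = P i" for i
  proof -
    have "mexp A ** (mat (exp (- c i)) ** P i) = mat (exp (- c i)) ** (mexp A ** P i)"
      by (rule matrix_mult_mat_shift)
    also have "\<dots> = P i"
      by (simp add: mexp_spectral_proj(2)[OF assms] matrix_mul_assoc mat_mult_mat
          exp_minus)
    finally show ?thesis .
  qed
  then have "(\<Sum>i\<in>UNIV. mexp A ** (mat (exp (- c i)) ** P i)) = (\<Sum>i\<in>UNIV. P i)"
    by simp
  also have "\<dots> = mat 1" using assms by (simp add: spectral_resolution_def)
  finally show ?thesis .
qed

text \<open>In the block decomposition given by the eigenprojections, conjugation by \<open>z\<^sup>A\<close> only rescales each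
  block.\<close>

lemma conj_pow_block:
  assumes "spectral_resolution A c P"
  shows "P i ** conj_pow l A B ** P j = mat (exp (l * (c i - c j))) ** (P i ** B ** P j)"
proof -
  note s = spectral_scale[OF assms, of l]
  have "P i ** conj_pow l A B ** P j = (P i ** mexp (mat l ** A)) ** B ** (mexp (- (mat l ** A)) ** P j)"
    by (simp add: conj_pow_def matrix_mul_assoc)
  also have "\<dots> = (mat (exp (l * c i)) ** P i) ** B ** (mat (exp (- (l * c j))) ** P j)"
    by (simp add: mexp_spectral_proj(1)[OF s] mexp_spectral_proj(2)[OF spectral_uminus[OF s]])
  also have "\<dots> = mat (exp (l * c i)) ** (mat (exp (- (l * c j))) ** (P i ** B ** P j))"
    using matrix_mult_mat_shift[of "P i ** B" "exp (- (l * c j))" "P j"]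
    by (simp only: matrix_mul_assoc[symmetric])
  finally show ?thesis
    by (simp add: matrix_mul_assoc mat_mult_mat mult_exp_exp algebra_simps)
qed

lemma conj_pow_charpoly:
  assumes "spectral_resolution A c P"
  shows "det (conj_pow l A B - mat z) = det (B - mat z)"
proof -
  let ?E = "mexp (mat l ** A)" and ?F = "mexp (- (mat l ** A))"
  have EF: "?E ** ?F = mat 1" by (rule mexp_mult_mexp_uminus[OF spectral_scale[OF assms]])
  have "?E ** (B - mat z) ** ?F = ?E ** B ** ?F - ?E ** mat z ** ?F"
    by (simp add: matrix_mult_diff_left matrix_mult_diff_right)
  also have "?E ** mat z = mat z ** ?E" by (rule mat_mult_commute[symmetric])
  finally have "?E ** (B - mat z) ** ?F = ?E ** B ** ?F - mat z ** (?E ** ?F)"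
    by (simp only: matrix_mul_assoc)
  then have "conj_pow l A B - mat z = ?E ** (B - mat z) ** ?F"
    by (simp add: conj_pow_def EF)
  then have "det (conj_pow l A B - mat z) = det (B - mat z) * (det ?E * det ?F)"
    by (simp add: det_mul)
  also have "det ?E * det ?F = 1" using EF by (metis det_mul det_I)
  finally show ?thesis by simp
qed

section \<open>Conjugation by powers of a block-diagonal matrix\<close>

text \<open>For \<open>\<sigma> = \<lambda>\<^sub>1 - \<lambda>\<^sub>2\<close>, the difference of the eigenvalues of the upper left block, this is the spectral
  projection \<open>(A - \<lambda>\<^sub>2)/(\<lambda>\<^sub>1 - \<lambda>\<^sub>2)\<close> of that block, extended by zero. Replacing \<open>\<sigma>\<close> by \<open>- \<sigma>\<close> exchanges the
  two eigenvalues.\<close>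

definition block_proj :: "complex \<Rightarrow> complex^3^3 \<Rightarrow> complex^3^3" where
  "block_proj \<sigma> A = (\<chi> i j. if i = 3 \<or> j = 3 then 0 else if i = j
      then 1 / 2 + (A$i$i - (A$1$1 + A$2$2) / 2) / \<sigma> else A$i$j / \<sigma>)"

definition corner :: "complex^3^3" where
  "corner = (\<chi> i j. if i = 3 \<and> j = 3 then 1 else 0)"

definition block_eigval :: "complex \<Rightarrow> complex^3^3 \<Rightarrow> complex" where
  "block_eigval \<sigma> A = (A$1$1 + A$2$2 + \<sigma>) / 2"

text \<open>The condition on \<open>\<sigma>\<^sup>2\<close> says that \<open>\<sigma>\<close> is a square root of the discriminant of the upper left block.
  Written in terms of the entries \<open>\<alpha>\<close>, \<open>\<beta>\<close>, \<open>\<gamma>\<close> of the first projection, everything follows from the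
  relation \<open>\<beta> \<gamma> = \<alpha> (1 - \<alpha>)\<close>.\<close>

lemma spectral_block:
  assumes \<sigma>: "\<sigma> \<noteq> 0" "\<sigma>^2 = (A$1$1 - A$2$2)^2 + 4 * A$1$2 * A$2$1"
  shows "spectral_resolution (delta_part 2 A)
    (\<lambda>i::3. if i = 1 then block_eigval \<sigma> A else if i = 2 then block_eigval (- \<sigma>) A else A$3$3)
    (\<lambda>i::3. if i = 1 then block_proj \<sigma> A else if i = 2 then block_proj (- \<sigma>) A else corner)"
proof -
  define \<alpha> \<beta> \<gamma> \<mu> where d: "\<alpha> = block_proj \<sigma> A $ 1 $ 1" "\<beta> = A$1$2 / \<sigma>" "\<gamma> = A$2$1 / \<sigma>"
    "\<mu> = block_eigval (- \<sigma>) A"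
  have rel: "\<beta> * \<gamma> = \<alpha> * (1 - \<alpha>)"
    using \<sigma> by (simp add: d block_proj_def power2_eq_square field_simps)
  have A: "A$1$1 = \<mu> + \<sigma> * \<alpha>" "A$1$2 = \<sigma> * \<beta>" "A$2$1 = \<sigma> * \<gamma>" "A$2$2 = \<mu> + \<sigma> * (1 - \<alpha>)"
    using \<sigma>(1) by (simp_all add: d block_proj_def block_eigval_def field_simps)
  have ev: "block_eigval \<sigma> A = \<mu> + \<sigma>" "block_eigval (- \<sigma>) A = \<mu>"
    by (simp_all add: d block_eigval_def field_simps)
  have B: "delta_part 2 A = (\<chi> i j. if i = 3 \<or> j = 3 then if i = j then A$3$3 else 0
      else if i = 1 then if j = 1 then \<mu> + \<sigma> * \<alpha> else \<sigma> * \<beta>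
      else if j = 1 then \<sigma> * \<gamma> else \<mu> + \<sigma> * (1 - \<alpha>))"
    by (simp add: vec_eq_iff forall_3 delta_part_def idx_def A)
  have p: "block_proj \<sigma> A = (\<chi> i j. if i = 3 \<or> j = 3 then 0
      else if i = 1 then if j = 1 then \<alpha> else \<beta> else if j = 1 then \<gamma> else 1 - \<alpha>)"
    using \<sigma>(1) by (simp add: vec_eq_iff forall_3 d block_proj_def field_simps)
  have m: "block_proj (- \<sigma>) A = (\<chi> i j. if i = 3 \<or> j = 3 then 0
      else if i = 1 then if j = 1 then 1 - \<alpha> else - \<beta> else if j = 1 then - \<gamma> else \<alpha>)"
    using \<sigma>(1) by (simp add: vec_eq_iff forall_3 d block_proj_def field_simps)
  have rel': "\<beta> * (\<gamma> * x) = \<alpha> * (1 - \<alpha>) * x" "\<gamma> * \<beta> = \<alpha> * (1 - \<alpha>)" "\<gamma> * (\<beta> * x) = \<alpha> * (1 - \<alpha>) * x" for x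
    using rel by (simp_all only: mult.assoc[symmetric] mult.commute[of \<gamma> \<beta>])
  show ?thesis
    unfolding spectral_resolution_def B p m ev
    by (simp add: forall_3 sum_3 vec_eq_iff matrix_matrix_mult_def mat_def corner_def)
       (simp add: algebra_simps rel rel')
qed

text \<open>The matrix \<open>B\<^sub>i\<^sub>3 B\<^sub>3\<^sub>j\<close>, in a form that passes through the eigenprojections.\<close>

definition outer_block :: "complex^3^3 \<Rightarrow> complex^3^3" where
  "outer_block B = B ** corner ** B"

lemma outer_block_nth: "outer_block B $ i $ j = B$i$3 * B$3$j"
  by (simp add: outer_block_def matrix_matrix_mult_def corner_def sum_3)

text \<open>The coefficient in \<open>N\<close> of the component that scales like \<open>z\<^sup>-\<^sup>\<sigma>\<close> under conjugation by \<open>z\<^sup>A\<close>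
  (see \<open>qform_block_proj\<close>), written out so that only cyclic products occur when \<open>N\<close> is
  \<open>outer_block A\<close>.\<close>

definition qform :: "complex \<Rightarrow> complex^3^3 \<Rightarrow> complex^3^3 \<Rightarrow> complex" where
  "qform \<sigma> A N = (1 - ((A$1$1 - A$2$2) / \<sigma>)^2) * (N$1$1 - N$2$2)
     - 2 * (A$1$1 - A$2$2) / \<sigma>^2 * (N$1$2 * A$2$1 + N$2$1 * A$1$2)
     + 2 / \<sigma> * (N$1$2 * A$2$1 - N$2$1 * A$1$2)"

text \<open>By the spectral projections, \<open>diag(1, -1)\<close> splits into eigenvectors of the commutator with the upper
  left block \<open>A\<close>. Pairing the eigenvector for \<open>\<sigma>\<close> with \<open>N\<close> gives half of \<open>qform\<close>.\<close>

lemma qform_block_proj: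
  assumes \<sigma>: "\<sigma> \<noteq> 0" "\<sigma>^2 = (A$1$1 - A$2$2)^2 + 4 * A$1$2 * A$2$1"
  and K: "K = block_proj (- \<sigma>) A ** N ** block_proj \<sigma> A"
  shows "qform \<sigma> A N = 2 * (K$1$1 - K$2$2)"
proof -
  obtain a b g e where abge: "a = A$1$1" "b = A$1$2" "g = A$2$1" "e = A$2$2" by auto
  have s: "\<sigma> * \<sigma> = (a - e) * (a - e) + 4 * b * g"
    using \<sigma>(2) by (simp add: abge power2_eq_square)
  have s': "\<sigma> * (\<sigma> * x) = ((a - e) * (a - e) + 4 * b * g) * x" for x
    using arg_cong[OF s, of "\<lambda>u. u * x"] by (simp only: mult.assoc)
  show ?thesis
    using \<sigma>(1)
    unfolding K qform_def
    by (simp add: sum_3 matrix_matrix_mult_def block_proj_def abge[symmetric]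
          power2_eq_square divide_simps)
       (simp add: algebra_simps s s')
qed

text \<open>\<open>P k\<close> in the middle is idempotent, so the product splits into two factors to which
  \<open>conj_pow_block\<close> applies; the factor of \<open>c k\<close> cancels.\<close>

lemma conj_pow_block2:
  assumes "spectral_resolution A c P"
  shows "P i ** (conj_pow l A B ** P k ** conj_pow l A B) ** P j
    = mat (exp (l * (c i - c j))) ** (P i ** (B ** P k ** B) ** P j)"
proof -
  have "P i ** (conj_pow l A B ** P k ** conj_pow l A B) ** P j
      = P i ** conj_pow l A B ** (P k ** P k) ** conj_pow l A B ** P j"
    using assms by (simp add: spectral_resolution_def matrix_mul_assoc)
  also have "\<dots> = (P i ** conj_pow l A B ** P k) ** (P k ** conj_pow l A B ** P j)"
    by (simp only: matrix_mul_assoc)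
  also have "\<dots> = mat (exp (l * (c i - c k))) ** ((P i ** B ** P k) **
      (mat (exp (l * (c k - c j))) ** (P k ** B ** P j)))"
    unfolding conj_pow_block[OF assms] by (simp only: matrix_mul_assoc)
  also have "\<dots> = mat (exp (l * (c i - c k))) ** (mat (exp (l * (c k - c j))) **
      ((P i ** B ** P k) ** (P k ** B ** P j)))"
    by (simp only: matrix_mult_mat_shift[of "P i ** B ** P k"])
  also have "\<dots> = mat (exp (l * (c i - c j))) ** ((P i ** B ** P k) ** (P k ** B ** P j))"
    by (simp add: matrix_mul_assoc mat_mult_mat mult_exp_exp algebra_simps)
  also have "(P i ** B ** P k) ** (P k ** B ** P j) = P i ** B ** (P k ** P k) ** B ** P j"
    by (simp only: matrix_mul_assoc)
  also have "\<dots> = P i ** (B ** P k ** B) ** P j"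
    using assms by (simp add: spectral_resolution_def matrix_mul_assoc)
  finally show ?thesis .
qed

lemma tendsto_matrix_mult [tendsto_intros]:
  fixes f :: "'a \<Rightarrow> complex^'n^'m" and g :: "'a \<Rightarrow> complex^'k^'n"
  assumes "(f \<longlongrightarrow> A) F" "(g \<longlongrightarrow> B) F"
  shows "((\<lambda>x. f x ** g x) \<longlongrightarrow> A ** B) F"
  unfolding matrix_matrix_mult_def using assms
  by (intro vec_tendstoI) (simp, intro tendsto_intros)

lemma tendsto_mat [tendsto_intros]:
  fixes f :: "'a \<Rightarrow> complex"
  assumes "(f \<longlongrightarrow> c) F"
  shows "((\<lambda>x. mat (f x) :: complex^'n^'n) \<longlongrightarrow> mat c) F"
  unfolding mat_def using assms by (intro vec_tendstoI) auto

lemma tendsto_qform: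
  assumes "\<sigma> \<noteq> 0"
    and lim: "((\<lambda>n. delta_part 2 (A n)) \<longlongrightarrow> delta_part 2 B) F"
    and N: "\<And>i j. i \<noteq> 3 \<Longrightarrow> j \<noteq> 3 \<Longrightarrow> ((\<lambda>n. N n $ i $ j) \<longlongrightarrow> M $ i $ j) F"
  shows "((\<lambda>n. qform \<sigma> (A n) (N n)) \<longlongrightarrow> qform \<sigma> B M) F"
proof -
  have lim': "((\<lambda>n. delta_part 2 (A n) $ i $ j) \<longlongrightarrow> delta_part 2 B $ i $ j) F" for i j
    by (intro tendsto_vec_nth lim)
  have entry: "delta_part 2 Z $ i $ j = Z $ i $ j" if "i \<noteq> 3" "j \<noteq> 3" for Z i j
    using that exhaust_3[of i] exhaust_3[of j] by (auto simp: delta_part_def idx_def)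
  have A: "((\<lambda>n. A n $ i $ j) \<longlongrightarrow> B $ i $ j) F" if "i \<noteq> 3" "j \<noteq> 3" for i j
    using lim'[of i j] by (simp add: entry[OF that])
  show ?thesis
    unfolding qform_def
    by (intro tendsto_add tendsto_diff tendsto_mult tendsto_divide tendsto_power tendsto_const A N)
       (use assms(1) in simp_all)
qed

text \<open>The four blocks of the outer product under conjugation: the diagonal ones are invariant, the
  other two scale with opposite powers. In particular they are recovered from the conjugated matrix.\<close>

lemma outer_block_conj_pow:
  assumes \<sigma>: "\<sigma> \<noteq> 0" "\<sigma>^2 = (A$1$1 - A$2$2)^2 + 4 * A$1$2 * A$2$1"
  defines "C \<equiv> \<lambda>l B. outer_block (conj_pow l (delta_part 2 A) B)"
  defines "p \<equiv> block_proj \<sigma> A" and "m \<equiv> block_proj (- \<sigma>) A"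
  shows "p ** outer_block B ** p = p ** C l B ** p"
    and "m ** outer_block B ** m = m ** C l B ** m"
    and "p ** outer_block B ** m = mat (exp (- (\<sigma> * l))) ** (p ** C l B ** m)"
    and "m ** outer_block B ** p = mat (exp (\<sigma> * l)) ** (m ** C l B ** p)"
proof -
  note b = conj_pow_block2[OF spectral_block[OF \<sigma>], where k = 3 and l = l and B = B]
  have d: "block_eigval \<sigma> A - block_eigval (- \<sigma>) A = \<sigma>" "block_eigval (- \<sigma>) A - block_eigval \<sigma> A = - \<sigma>"
    by (simp_all add: block_eigval_def field_simps)
  have inv: "mat (exp z) ** (mat (exp (- z)) ** M) = M" "mat (exp (- z)) ** (mat (exp z) ** M) = M"
    for z and M :: "complex^3^3"
    by (simp_all add: matrix_mul_assoc mat_mult_mat mult_exp_exp)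
  show "p ** outer_block B ** p = p ** C l B ** p"
    using b[of 1 1] by (simp add: C_def outer_block_def p_def)
  show "m ** outer_block B ** m = m ** C l B ** m"
    using b[of 2 2] by (simp add: C_def outer_block_def m_def)
  have "p ** C l B ** m = mat (exp (\<sigma> * l)) ** (p ** outer_block B ** m)"
    using b[of 1 2] by (simp add: C_def outer_block_def p_def m_def d mult.commute)
  then show "p ** outer_block B ** m = mat (exp (- (\<sigma> * l))) ** (p ** C l B ** m)"
    by (simp only: inv)
  have "m ** C l B ** p = mat (exp (- (\<sigma> * l))) ** (m ** outer_block B ** p)"
    using b[of 2 1] by (simp add: C_def outer_block_def p_def m_def d mult.commute)
  then show "m ** outer_block B ** p = mat (exp (\<sigma> * l)) ** (m ** C l B ** p)"
    by (simp only: inv)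
qed

text \<open>The component \<open>m N p\<close> selected by \<open>qform \<sigma> A\<close> can be computed exactly from the conjugated matrix,
  whence \<open>X qform \<sigma> A N\<close> converges to the value at the boundary. The claim has \<open>qform \<sigma> (\<Phi>s n)\<close>
  instead, because only then the value is made of cyclic products of \<open>\<Phi>s n\<close>. The exchange is
  harmless since the upper left part of \<open>X N\<close> converges, although \<open>N\<close> itself may grow.\<close>

lemma qform_limit:
  fixes \<Phi>s :: "'a \<Rightarrow> complex^3^3" and l X :: "'a \<Rightarrow> complex"
  assumes F: "F \<noteq> bot"
    and \<sigma>: "\<sigma> \<noteq> 0" "\<sigma>^2 = (A$1$1 - A$2$2)^2 + 4 * A$1$2 * A$2$1"
    and lim1: "((\<lambda>n. delta_part 2 (\<Phi>s n)) \<longlongrightarrow> delta_part 2 A) F"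
    and lim2: "((\<lambda>n. conj_pow (l n) (delta_part 2 A) (\<Phi>s n)) \<longlongrightarrow> A) F"
    and X: "(X \<longlongrightarrow> X0) F" "((\<lambda>n. X n * exp (\<sigma> * l n)) \<longlongrightarrow> 1) F"
  shows "((\<lambda>n. X n * qform \<sigma> (\<Phi>s n) (outer_block (\<Phi>s n))) \<longlongrightarrow> qform \<sigma> A (outer_block A)) F"
proof -
  define p m where "p = block_proj \<sigma> A" and "m = block_proj (- \<sigma>) A"
  define C where "C n = outer_block (conj_pow (l n) (delta_part 2 A) (\<Phi>s n))" for n
  define T where "T n = mat (X n) ** outer_block (\<Phi>s n)" for n
  have C: "(C \<longlongrightarrow> outer_block A) F"
    unfolding C_def outer_block_def by (intro tendsto_intros lim2)
  note bl = outer_block_conj_pow[OF \<sigma>, folded p_def m_def, where l = "l n" and B = "\<Phi>s n" for n, folded C_def]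
  \<comment> \<open>\<open>X exp(- \<sigma> l) = X\<^sup>2 / (X exp(\<sigma> l))\<close>, so the opposite power is under control as well.\<close>
  have X2: "((\<lambda>n. X n * exp (- (\<sigma> * l n))) \<longlongrightarrow> X0^2 / 1) F"
  proof -
    have "((\<lambda>n. X n ^ 2 / (X n * exp (\<sigma> * l n))) \<longlongrightarrow> X0^2 / 1) F"
      by (intro tendsto_intros X) simp
    moreover have "X n ^ 2 / (X n * exp (\<sigma> * l n)) = X n * exp (- (\<sigma> * l n))" for n
      by (cases "X n = 0") (simp_all add: power2_eq_square exp_minus field_simps)
    ultimately show ?thesis by simp
  qed
  have bl': "p ** T n ** p = mat (X n) ** (p ** C n ** p)"
     "m ** T n ** m = mat (X n) ** (m ** C n ** m)"
     "p ** T n ** m = mat (X n * exp (- (\<sigma> * l n))) ** (p ** C n ** m)"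
     "m ** T n ** p = mat (X n * exp (\<sigma> * l n)) ** (m ** C n ** p)" for n
  proof -
    have T: "q ** T n ** q' = mat (X n) ** (q ** outer_block (\<Phi>s n) ** q')" for q q' :: "complex^3^3"
    proof -
      have "q ** T n ** q' = mat (X n) ** (q ** outer_block (\<Phi>s n)) ** q'"
        unfolding T_def matrix_mult_mat_shift ..
      then show ?thesis by (simp only: matrix_mul_assoc)
    qed
    show "p ** T n ** p = mat (X n) ** (p ** C n ** p)"
      "m ** T n ** m = mat (X n) ** (m ** C n ** m)"
      "p ** T n ** m = mat (X n * exp (- (\<sigma> * l n))) ** (p ** C n ** m)"
      "m ** T n ** p = mat (X n * exp (\<sigma> * l n)) ** (m ** C n ** p)"
      unfolding T bl
      by (simp_all only: matrix_mul_assoc mat_mult_mat)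
  qed
  have lims: "((\<lambda>n. p ** T n ** p) \<longlongrightarrow> mat X0 ** (p ** outer_block A ** p)) F"
     "((\<lambda>n. m ** T n ** m) \<longlongrightarrow> mat X0 ** (m ** outer_block A ** m)) F"
     "((\<lambda>n. p ** T n ** m) \<longlongrightarrow> mat (X0^2 / 1) ** (p ** outer_block A ** m)) F"
     "((\<lambda>n. m ** T n ** p) \<longlongrightarrow> mat 1 ** (m ** outer_block A ** p)) F"
    unfolding bl' by (intro tendsto_intros X X2 C)+
  define L where "L = mat X0 ** (p ** outer_block A ** p) + mat X0 ** (m ** outer_block A ** m)
     + mat (X0^2 / 1) ** (p ** outer_block A ** m) + mat 1 ** (m ** outer_block A ** p)"
  \<comment> \<open>The sum \<open>p + m\<close> is \<open>diag(1, 1, 0)\<close>, so \<open>N n\<close> is the upper left part of \<open>T n\<close>.\<close>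
  define N where "N n = p ** T n ** p + m ** T n ** m + p ** T n ** m + m ** T n ** p" for n
  have NL: "(N \<longlongrightarrow> L) F"
    unfolding N_def L_def by (intro tendsto_add lims)
  have N: "N n = (p + m) ** T n ** (p + m)" for n
    unfolding N_def by (simp add: vec_eq_iff matrix_matrix_mult_def algebra_simps sum.distrib)
  have U: "(p + m) $ i $ j = (if i \<noteq> 3 \<and> i = j then 1 else 0)" for i j
    by (simp add: p_def m_def block_proj_def)
  have NT: "N n $ i $ j = T n $ i $ j" if "i \<noteq> 3" "j \<noteq> 3" for n i j
    using that exhaust_3[of i] exhaust_3[of j]
    unfolding N by (auto simp: matrix_matrix_mult_def U sum_3 simp del: vector_add_component)
  have TL: "((\<lambda>n. T n $ i $ j) \<longlongrightarrow> L $ i $ j) F" if "i \<noteq> 3" "j \<noteq> 3" for i j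
    unfolding NT[OF that, symmetric] by (intro tendsto_intros NL)
  have 1: "((\<lambda>n. qform \<sigma> (\<Phi>s n) (T n)) \<longlongrightarrow> qform \<sigma> A L) F"
    by (intro tendsto_qform \<sigma>(1) lim1 TL)
  have 2: "((\<lambda>n. qform \<sigma> A (T n)) \<longlongrightarrow> qform \<sigma> A L) F"
    by (intro tendsto_qform \<sigma>(1) TL) auto
  have 3: "((\<lambda>n. qform \<sigma> A (T n)) \<longlongrightarrow> qform \<sigma> A (outer_block A)) F"
    unfolding qform_block_proj[OF \<sigma> refl] p_def[symmetric] m_def[symmetric]
    using lims(4)[unfolded matrix_mul_lid]
    by (intro tendsto_mult tendsto_diff tendsto_const tendsto_vec_nth)
  have "qform \<sigma> A L = qform \<sigma> A (outer_block A)"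
    by (rule tendsto_unique[OF F 2 3])
  moreover have "qform \<sigma> B (mat z ** M) = z * qform \<sigma> B M" for z B M
    by (simp add: qform_def mat_mult_nth) (simp add: algebra_simps)
  ultimately show ?thesis
    using 1 unfolding T_def by simp
qed

section \<open>Diagonal conjugation and characteristic polynomials\<close>

definition unit_mat :: "'n \<Rightarrow> complex^'n^'n" where
  "unit_mat k = (\<chi> i j. if i = k \<and> j = k then 1 else 0)"

lemma unit_mat_mult_nth: "(unit_mat k ** A) $ i $ j = (if i = k then A $ k $ j else 0)"
proof -
  have "(unit_mat k ** A) $ i $ j = (\<Sum>l\<in>UNIV. unit_mat k $ i $ l * A $ l $ j)"
    by (simp add: matrix_matrix_mult_def)
  also have "\<dots> = (\<Sum>l\<in>UNIV. if l = k then if i = k then A $ k $ j else 0 else 0)"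
    by (intro sum.cong refl) (auto simp: unit_mat_def)
  finally show ?thesis by simp
qed

lemma mult_unit_mat_nth: "(A ** unit_mat k) $ i $ j = (if j = k then A $ i $ k else 0)"
proof -
  have "(A ** unit_mat k) $ i $ j = (\<Sum>l\<in>UNIV. A $ i $ l * unit_mat k $ l $ j)"
    by (simp add: matrix_matrix_mult_def)
  also have "\<dots> = (\<Sum>l\<in>UNIV. if l = k then if j = k then A $ i $ k else 0 else 0)"
    by (intro sum.cong refl) (auto simp: unit_mat_def)
  finally show ?thesis by simp
qed

lemma spectral_diag: "spectral_resolution (diag_part A) (\<lambda>i. A $ i $ i) unit_mat"
proof -
  have "diag_part A ** unit_mat k = mat (A $ k $ k) ** unit_mat k" for k
    unfolding vec_eq_iff mult_unit_mat_nth mat_mult_nth by (auto simp: unit_mat_def diag_part_def mat_def)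
  moreover have "(\<Sum>k\<in>UNIV. unit_mat k $ i $ j) = (mat 1 :: complex^'a^'a) $ i $ j" for i j
  proof (cases "i = j")
    case True
    then have "(\<Sum>k\<in>UNIV. unit_mat k $ i $ j) = (\<Sum>k\<in>UNIV. if k = i then 1 else 0 :: complex)"
      by (intro sum.cong) (auto simp: unit_mat_def)
    with True show ?thesis by (simp add: mat_def)
  next
    case False
    then have "unit_mat k $ i $ j = 0" for k by (auto simp: unit_mat_def)
    with False show ?thesis by (simp add: mat_def)
  qed
  then have "(\<Sum>k\<in>UNIV. unit_mat k) = (mat 1 :: complex^'a^'a)"
    by (simp add: vec_eq_iff)
  moreover have "unit_mat i ** unit_mat j = (if i = j then unit_mat i else 0)" for i j :: 'a
    by (auto simp: vec_eq_iff unit_mat_mult_nth) (auto simp: unit_mat_def)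
  ultimately show ?thesis by (simp add: spectral_resolution_def)
qed

lemma conj_pow_diag_nth:
  "conj_pow l (diag_part A) B $ i $ j = exp (l * (A$i$i - A$j$j)) * B $ i $ j"
proof -
  have "(unit_mat i ** X ** unit_mat j) $ i $ j = X $ i $ j" for X
    by (simp add: unit_mat_mult_nth mult_unit_mat_nth)
  with conj_pow_block[OF spectral_diag[of A], of i l B j]
  show ?thesis by (metis mat_mult_nth)
qed

lemma qform_outer_block:
  "qform \<sigma> A (outer_block A) = (1 - ((A$1$1 - A$2$2) / \<sigma>)^2) * (A$1$3 * A$3$1 - A$2$3 * A$3$2)
     - 2 * (A$1$1 - A$2$2) / \<sigma>^2 * (A$1$3 * A$3$2 * A$2$1 + A$2$3 * A$3$1 * A$1$2)
     + 2 / \<sigma> * (A$1$3 * A$3$2 * A$2$1 - A$2$3 * A$3$1 * A$1$2)"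
  by (simp add: qform_def outer_block_nth)

text \<open>The exponential factors of a diagonal conjugation telescope along cycles.\<close>

lemma conj_pow_diag_products:
  fixes A B :: "complex^3^3"
  assumes C_def: "C = conj_pow l (diag_part A) B"
  shows "C$i$i = B$i$i" "C$i$j * C$j$i = B$i$j * B$j$i"
    "C$i$j * C$j$k * C$k$i = B$i$j * B$j$k * B$k$i"
proof -
  show "C$i$i = B$i$i" by (simp add: C_def conj_pow_diag_nth)
  have [simp]: "exp (l * (A$i$i - A$j$j)) * exp (l * (A$j$j - A$i$i)) = 1" for i j
    by (simp add: mult_exp_exp algebra_simps)
  have "C$i$j * C$j$i = (exp (l * (A$i$i - A$j$j)) * exp (l * (A$j$j - A$i$i))) * (B$i$j * B$j$i)"
    by (simp only: C_def conj_pow_diag_nth mult.assoc mult.left_commute)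
  then show "C$i$j * C$j$i = B$i$j * B$j$i" by simp
  have [simp]: "exp (l * (A$i$i - A$j$j)) * exp (l * (A$j$j - A$k$k)) * exp (l * (A$k$k - A$i$i)) = 1" for i j k
    by (simp add: mult_exp_exp algebra_simps)
  have "C$i$j * C$j$k * C$k$i = (exp (l * (A$i$i - A$j$j)) * exp (l * (A$j$j - A$k$k)) *
      exp (l * (A$k$k - A$i$i))) * (B$i$j * B$j$k * B$k$i)"
    by (simp only: C_def conj_pow_diag_nth mult.assoc mult.left_commute)
  then show "C$i$j * C$j$k * C$k$i = B$i$j * B$j$k * B$k$i" by simp
qed

lemma eigenvals_det:
  assumes "z \<in> eigenvals (A :: complex^'n^'n)"
  shows "det (A - mat z) = 0"
proof (rule ccontr)
  assume "det (A - mat z) \<noteq> 0"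
  moreover obtain v where v: "v \<noteq> 0" "A *v v = z *s v"
    using assms by (auto simp: eigenvals_def)
  moreover have "mat z *v v = z *s v"
    by (simp add: vec_eq_iff matrix_vector_mult_def mat_def if_distrib[of "\<lambda>x. x * _"] cong: if_cong)
  ultimately have "(A - mat z) *v v = 0"
    by (simp add: matrix_vector_mult_diff_rdistrib)
  with v(1) \<open>det (A - mat z) \<noteq> 0\<close> show False
    using invertible_det_nz[of "A - mat z"] invertible_left_inverse[of "A - mat z"]
      matrix_left_invertible_ker[of "A - mat z"] by blast
qed

definition minors2 :: "complex^3^3 \<Rightarrow> complex" where
  "minors2 A = A$1$1 * A$2$2 + A$1$1 * A$3$3 + A$2$2 * A$3$3
     - (A$1$2 * A$2$1 + A$1$3 * A$3$1 + A$2$3 * A$3$2)"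

lemma charpoly3:
  "det (A - mat z :: complex^3^3) = - (z^3) + (A$1$1 + A$2$2 + A$3$3) * z^2 - minors2 A * z + det A"
  by (simp add: det_3 minors2_def mat_def algebra_simps power2_eq_square power3_eq_cube)

text \<open>A cubic with three distinct known roots is determined by them.\<close>

lemma charpoly_of_eigenvals:
  fixes A :: "complex^3^3"
  assumes ev: "eigenvals A = {0, c1, c2}" and d: "distinct [0, c1, c2]"
  shows "det A = 0" "minors2 A = c1 * c2"
proof -
  have z: "det (A - mat 0) = 0" "det (A - mat c1) = 0" "det (A - mat c2) = 0"
    using eigenvals_det[of _ A] unfolding ev by blast+
  then show d0: "det A = 0" by simp
  define t where "t = A$1$1 + A$2$2 + A$3$3"
  have "c1 * (minors2 A - (t * c1 - c1^2)) = 0" "c2 * (minors2 A - (t * c2 - c2^2)) = 0"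
    using z(2,3) unfolding charpoly3 d0 t_def by (simp_all add: algebra_simps power2_eq_square power3_eq_cube)
  moreover have "c1 \<noteq> 0" "c2 \<noteq> 0" using d by auto
  ultimately have e: "minors2 A = t * c1 - c1^2" "minors2 A = t * c2 - c2^2"
    by (metis mult_eq_0_iff eq_iff_diff_eq_0)+
  then have "(c1 - c2) * (t - c1 - c2) = 0" by (simp add: algebra_simps power2_eq_square)
  moreover have "c1 - c2 \<noteq> 0" using d by auto
  ultimately have "t - c1 - c2 = 0" by (metis mult_eq_0_iff)
  then have "t = c1 + c2" by (simp add: algebra_simps)
  with e(1) show "minors2 A = c1 * c2" by (simp add: algebra_simps power2_eq_square)
qed

lemma invariants_of_charpoly:
  fixes A B :: "complex^3^3"
  assumes "\<And>z. det (A - mat z) = det (B - mat z)"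
  shows "det A = det B" "minors2 A = minors2 B"
proof -
  show d: "det A = det B" using assms[of 0] by simp
  \<comment> \<open>The odd part of the characteristic polynomial at 1 isolates the sum of the minors.\<close>
  have e: "det (A - mat (-1)) - det (A - mat 1) = det (B - mat (-1)) - det (B - mat 1)"
    by (simp only: assms)
  have "det (C - mat (-1)) - det (C - mat 1) = 2 + 2 * minors2 C" for C :: "complex^3^3"
    unfolding charpoly3 by simp
  with e show "minors2 A = minors2 B" by simp
qed

lemma tendsto_det_minors2:
  fixes A :: "'a \<Rightarrow> complex^3^3"
  assumes "(A \<longlongrightarrow> B) F"
  shows "((\<lambda>n. det (A n)) \<longlongrightarrow> det B) F" "((\<lambda>n. minors2 (A n)) \<longlongrightarrow> minors2 B) F"
  unfolding det_3 minors2_def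
  by (intro tendsto_add tendsto_diff tendsto_mult tendsto_vec_nth assms)+

lemma delta_part_2_nth_diag: "delta_part 2 A $ i $ i = A $ i $ i"
  by (simp add: delta_part_def)

lemma delta_part_1: "delta_part 1 A = diag_part A"
proof -
  have "delta_part 1 A $ i $ j = diag_part A $ i $ j" for i j
    using exhaust_3[of i] exhaust_3[of j] by (auto simp: delta_part_def diag_part_def idx_def)
  then show ?thesis by (simp add: vec_eq_iff)
qed

section \<open>Generic solutions in the logarithmic coordinate\<close>

text \<open>The chart \<open>s \<mapsto> e\<^sup>i\<^sup>a\<^sup>+\<^sup>s\<close>. For \<open>w \<le> pi\<close> it maps the half-strip \<open>half_strip w r\<close> onto the sector with direction \<open>a\<close>,
  half-opening \<open>w\<close> and radius \<open>r\<close>, and turns the branch \<open>branch_log a\<close> into \<open>s + i a\<close>.\<close>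

definition log_chart :: "real \<Rightarrow> complex \<Rightarrow> complex" where
  "log_chart a s = exp (s + \<i> * of_real a)"

definition half_strip :: "real \<Rightarrow> real \<Rightarrow> complex set" where
  "half_strip w r = {s. \<bar>Im s\<bar> < w \<and> Re s < ln r}"

lemma open_half_strip: "open (half_strip w r)"
proof -
  have "half_strip w r = (\<lambda>s. \<bar>Im s\<bar>) -` {..<w} \<inter> Re -` {..<ln r}"
    by (auto simp: half_strip_def)
  moreover have "open ((\<lambda>s. \<bar>Im s\<bar>) -` {..<w})" "open (Re -` {..<ln r})"
    by (intro continuous_open_vimage continuous_intros; simp)+
  ultimately show ?thesis by (simp add: open_Int)
qed

lemma branch_log_log_chart:
  assumes "- pi < Im s" "Im s \<le> pi"
  shows "branch_log a (log_chart a s) = s + \<i> * of_real a"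
proof -
  have "log_chart a s * cis (- a) = exp s"
    by (simp add: log_chart_def cis_conv_exp exp_add exp_minus field_simps)
  then show ?thesis using assms by (simp add: branch_log_def)
qed

lemma branch_pow_log_chart:
  assumes "- pi < Im s" "Im s \<le> pi"
  shows "branch_pow a (log_chart a s) c = exp (c * (s + \<i> * of_real a))"
  by (simp add: branch_pow_def branch_log_log_chart[OF assms])

lemma log_chart_in_sector:
  assumes "s \<in> half_strip w r" "w \<le> pi" "0 < r"
  shows "log_chart a s \<in> sector_at_0 a w r"
proof -
  have "exp (Re s) < r"
    using assms by (metis (no_types, lifting) exp_less_cancel_iff exp_ln mem_Collect_eq half_strip_def)
  moreover have "branch_log a (log_chart a s) = s + \<i> * of_real a"
    using assms by (intro branch_log_log_chart) (auto simp: half_strip_def)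
  moreover have "log_chart a s \<noteq> 0" "cmod (log_chart a s) = exp (Re s)" by (simp_all add: log_chart_def)
  ultimately show ?thesis
    using assms(1) by (simp add: sector_at_0_def sector_def half_strip_def)
qed

lemma inj_on_log_chart: "w \<le> pi \<Longrightarrow> inj_on (log_chart a) (half_strip w r)"
  by (rule inj_on_inverseI[where g = "\<lambda>z. branch_log a z - \<i> * of_real a"])
     (subst branch_log_log_chart, auto simp: half_strip_def)

lemma log_chart_has_derivative: "(log_chart a has_field_derivative log_chart a s) (at s)"
  unfolding log_chart_def by (auto intro!: derivative_eq_intros)

lemma open_log_chart_image: "w \<le> pi \<Longrightarrow> open (log_chart a ` half_strip w r)"
proof -
  assume "w \<le> pi"
  moreover have "log_chart a holomorphic_on half_strip w r"
    using log_chart_has_derivative by (meson field_differentiable_at_within field_differentiable_def holomorphic_onI)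
  ultimately show ?thesis by (intro open_mapping_thm3 open_half_strip inj_on_log_chart)
qed

text \<open>The filter \<open>x \<rightarrow> 0\<close> in the sector, seen in the logarithmic coordinate: \<open>Re s\<close> tends to
  minus infinity inside the half-strip.\<close>

definition to_origin :: "real \<Rightarrow> real \<Rightarrow> complex filter" where
  "to_origin w r = inf (filtercomap Re at_bot) (principal (half_strip w r))"

lemma eventually_to_origin:
  "eventually P (to_origin w r) \<longleftrightarrow> (\<exists>R. \<forall>s\<in>half_strip w r. Re s < R \<longrightarrow> P s)"
  unfolding to_origin_def eventually_inf_principal eventually_filtercomap_at_bot_dense
  by blast

text \<open>The imaginary part of \<open>s\<close> is bounded on the half-strip, so the modulus is governed by \<open>Re c * Re s\<close>.\<close>

lemma tendsto_exp_to_origin: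
  assumes "0 < Re c"
  shows "((\<lambda>s. exp (c * (s + b))) \<longlongrightarrow> 0) (to_origin w r)"
proof (rule Lim_null_comparison)
  have "norm (exp (c * (s + b))) \<le> exp (Re c * Re s) * exp (\<bar>Im c\<bar> * w + Re (c * b))"
    if "s \<in> half_strip w r" for s
  proof -
    have "- (Im c * Im s) \<le> \<bar>Im c\<bar> * \<bar>Im s\<bar>" by (metis abs_ge_minus_self abs_mult)
    also have "\<dots> \<le> \<bar>Im c\<bar> * w" using that by (intro mult_left_mono) (auto simp: half_strip_def)
    finally show ?thesis by (simp add: mult_exp_exp algebra_simps)
  qed
  then show "\<forall>\<^sub>F s in to_origin w r. norm (exp (c * (s + b))) \<le>
      exp (Re c * Re s) * exp (\<bar>Im c\<bar> * w + Re (c * b))"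
    unfolding eventually_to_origin by blast
  have "((\<lambda>t. exp (Re c * t)) \<longlongrightarrow> 0) at_bot"
    using assms by (intro filterlim_compose[OF exp_at_bot] filterlim_tendsto_pos_mult_at_bot[OF tendsto_const])
        (auto simp: filterlim_ident)
  then have "((\<lambda>s. exp (Re c * Re s)) \<longlongrightarrow> 0) (filtercomap Re at_bot)"
    by (rule filterlim_compose) (rule filterlim_filtercomap)
  then have "((\<lambda>s. exp (Re c * Re s)) \<longlongrightarrow> 0) (to_origin w r)"
    unfolding to_origin_def by (rule tendsto_mono[rotated]) simp
  then show "((\<lambda>s. exp (Re c * Re s) * exp (\<bar>Im c\<bar> * w + Re (c * b))) \<longlongrightarrow> 0) (to_origin w r)"
    by (rule tendsto_mult_left_zero)
qed

lemma filterlim_log_chart: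
  assumes "w \<le> pi" "0 < r"
  shows "filterlim (log_chart a) (at 0 within sector_at_0 a w r) (to_origin w r)"
proof -
  have "(log_chart a \<longlongrightarrow> 0) (to_origin w r)"
    using tendsto_exp_to_origin[of 1 "\<i> * of_real a"] by (simp add: log_chart_def[abs_def])
  moreover have "\<forall>\<^sub>F s in to_origin w r. log_chart a s \<in> sector_at_0 a w r \<and> log_chart a s \<noteq> 0"
    unfolding eventually_to_origin using log_chart_in_sector[OF _ assms] by (auto simp: log_chart_def)
  ultimately show ?thesis
    by (simp add: filterlim_at)
qed

lemma filterlim_real_to_origin:
  assumes "0 < w"
  shows "filterlim of_real (to_origin w r) at_bot"
proof -
  have "\<exists>N. \<forall>t\<le>N. P (complex_of_real t)" if "\<forall>s\<in>half_strip w r. Re s < R \<longrightarrow> P s" for P R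
  proof (intro exI[of _ "min R (ln r) - 1"] allI impI)
    fix t assume "t \<le> min R (ln r) - 1"
    with that assms show "P (complex_of_real t)" by (auto simp: half_strip_def)
  qed
  then show ?thesis
    unfolding filterlim_iff eventually_to_origin eventually_at_bot_linorder by blast
qed

text \<open>Around a real point of the half-strip there is a disc of a radius that does not depend on the point,
  so Cauchy's inequality passes decay from a function to its derivative. This is the reason for
  the logarithmic coordinate: in \<open>x\<close> the discs would have to shrink.\<close>

lemma deriv_tendsto_0_on_half_strip:
  assumes "0 < w" and hol: "g holomorphic_on half_strip w r" and lim: "(g \<longlongrightarrow> 0) (to_origin w r)"
  shows "((\<lambda>t. deriv g (of_real t)) \<longlongrightarrow> 0) at_bot"
  unfolding tendsto_iff dist_norm diff_zero
proof (intro allI impI)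
  fix e :: real assume e: "0 < e"
  define d where "d = w / 2"
  have d: "0 < d" "d < w" using assms by (auto simp: d_def)
  have "0 < e * d / 2" using e d by simp
  from tendstoD[OF lim this] have "\<forall>\<^sub>F s in to_origin w r. norm (g s) < e * d / 2"
    by (simp only: dist_norm diff_zero)
  then obtain R where R: "\<And>s. s \<in> half_strip w r \<Longrightarrow> Re s < R \<Longrightarrow> norm (g s) < e * d / 2"
    by (auto simp: eventually_to_origin)
  have "norm (deriv g (of_real t)) < e" if t: "t \<le> min R (ln r) - d - 1" for t
  proof -
    have near: "s \<in> half_strip w r \<and> Re s < R" if "dist (of_real t) s \<le> d" for s
    proof -
      have "\<bar>Re (of_real t - s)\<bar> \<le> d" "\<bar>Im (of_real t - s)\<bar> \<le> d"
        using that abs_Re_le_cmod[of "of_real t - s"] abs_Im_le_cmod[of "of_real t - s"]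
        by (auto simp: dist_norm)
      with t d show ?thesis by (auto simp: half_strip_def)
    qed
    then have sub: "cball (of_real t) d \<subseteq> half_strip w r" by auto
    have "norm ((deriv ^^ 1) g (of_real t)) \<le> fact 1 * (e * d / 2) / d ^ 1"
    proof (rule Cauchy_inequality)
      show "g holomorphic_on ball (of_real t) d"
        by (rule holomorphic_on_subset[OF hol]) (use sub ball_subset_cball in blast)
      show "continuous_on (cball (of_real t) d) g"
        by (rule holomorphic_on_imp_continuous_on[OF holomorphic_on_subset[OF hol sub]])
      show "norm (g s) \<le> e * d / 2" if "norm (of_real t - s) = d" for s
        using near[of s] R[of s] that by (force simp: dist_norm)
    qed (use d in auto)
    also have "\<dots> < e" using e d by simp
    finally show ?thesis by simp
  qed
  then show "\<forall>\<^sub>F t in at_bot. norm (deriv g (of_real t)) < e"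
    unfolding eventually_at_bot_linorder by blast
qed

text \<open>The leading terms of \<open>x\<^sup>\<sigma>\<^sup>-\<^sup>1 y\<close> as a polynomial in \<open>X = x\<^sup>\<sigma>\<close>.\<close>

definition lead :: "complex \<Rightarrow> complex \<Rightarrow> complex \<Rightarrow> complex \<Rightarrow> complex \<Rightarrow> complex" where
  "lead \<sigma> J t1 t2 X = J + J2_coeff \<sigma> t1 t2 * X + J1_coeff \<sigma> J t1 t2 * X^2"

text \<open>Both cases of the generic behaviour in one formula. If \<open>Re \<sigma> > 0\<close>, then \<open>X\<close> tends to 0 and the two
  additional terms are part of the error.\<close>

lemma generic_remainder:
  assumes w: "0 < w" "w \<le> pi" and r: "0 < r" and D: "D = sector_at_0 a w r"
    and gen: "generic_behaviour \<sigma> J t1 t2 a D y"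
  defines "L \<equiv> \<lambda>s. s + \<i> * complex_of_real a"
  shows "((\<lambda>s. exp ((\<sigma> - 1) * L s) * y (log_chart a s) - lead \<sigma> J t1 t2 (exp (\<sigma> * L s))) \<longlongrightarrow> 0) (to_origin w r)"
proof (cases "0 < Re \<sigma>")
  case True
  then obtain h \<epsilon> where h: "\<epsilon> > 0" "h \<in> O[at 0 within D](\<lambda>x. of_real (cmod x powr \<epsilon>))"
    "\<And>x. x \<in> D \<Longrightarrow> y x = J * branch_pow a x (1 - \<sigma>) * (1 + h x)"
    using gen by (auto simp: generic_behaviour_def)
  from h(2) obtain c where c: "\<forall>\<^sub>F x in at 0 within D. norm (h x) \<le> c * norm (complex_of_real (cmod x powr \<epsilon>))"
    by (elim landau_o.bigE)
  have "\<forall>\<^sub>F s in to_origin w r. norm (h (log_chart a s)) \<le> c * norm (complex_of_real (cmod (log_chart a s) powr \<epsilon>))"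
    using filterlim_log_chart[OF w(2) r] c unfolding D filterlim_iff by blast
  then have "\<forall>\<^sub>F s in to_origin w r. norm (h (log_chart a s)) \<le> norm (of_real c * exp (of_real \<epsilon> * L s))"
    by (rule eventually_mono) (auto simp: log_chart_def L_def norm_mult powr_def abs_le_iff intro: order_trans[OF _ mult_right_mono[OF abs_ge_self]])
  moreover have "((\<lambda>s. of_real c * exp (of_real \<epsilon> * L s)) \<longlongrightarrow> 0) (to_origin w r)"
    unfolding L_def using h(1) by (intro tendsto_mult_right_zero tendsto_exp_to_origin) simp
  ultimately have h0: "((\<lambda>s. h (log_chart a s)) \<longlongrightarrow> 0) (to_origin w r)"
    by (rule Lim_null_comparison[OF _ tendsto_norm_zero])
  have X0: "((\<lambda>s. exp (\<sigma> * L s)) \<longlongrightarrow> 0) (to_origin w r)"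
    unfolding L_def using True by (rule tendsto_exp_to_origin)
  have "((\<lambda>s. J * (1 + h (log_chart a s)) - lead \<sigma> J t1 t2 (exp (\<sigma> * L s))) \<longlongrightarrow> J * (1 + 0) - lead \<sigma> J t1 t2 0) (to_origin w r)"
    unfolding lead_def by (intro tendsto_intros h0 X0)
  then have "((\<lambda>s. J * (1 + h (log_chart a s)) - lead \<sigma> J t1 t2 (exp (\<sigma> * L s))) \<longlongrightarrow> 0) (to_origin w r)"
    by (simp add: lead_def)
  moreover have "\<forall>\<^sub>F s in to_origin w r. J * (1 + h (log_chart a s)) = exp ((\<sigma> - 1) * L s) * y (log_chart a s)"
    unfolding eventually_to_origin
  proof (intro exI[of _ 0] ballI impI)
    fix s assume s: "s \<in> half_strip w r"
    then have "exp ((\<sigma> - 1) * L s) * branch_pow a (log_chart a s) (1 - \<sigma>) = 1"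
      using w by (subst branch_pow_log_chart) (auto simp: half_strip_def L_def mult_exp_exp algebra_simps)
    then show "J * (1 + h (log_chart a s)) = exp ((\<sigma> - 1) * L s) * y (log_chart a s)"
      unfolding h(3)[unfolded D, OF log_chart_in_sector[OF s w(2) r]] by (simp add: algebra_simps)
  qed
  ultimately show ?thesis
    by (rule Lim_transform_eventually[OF _ eventually_mono]) simp
next
  case False
  define q where "q x = y x - (J * branch_pow a x (1 - \<sigma>) + J1_coeff \<sigma> J t1 t2 * branch_pow a x (1 + \<sigma>)
                    + J2_coeff \<sigma> t1 t2 * x)" for x
  have "q \<in> O[at 0 within D](\<lambda>x. branch_pow a x (2 - \<sigma>))"
    using False gen by (simp add: generic_behaviour_def q_def[abs_def])
  then obtain c where c: "\<forall>\<^sub>F x in at 0 within D. norm (q x) \<le> c * norm (branch_pow a x (2 - \<sigma>))"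
    by (elim landau_o.bigE)
  have ev: "\<forall>\<^sub>F s in to_origin w r. norm (q (log_chart a s)) \<le> c * norm (branch_pow a (log_chart a s) (2 - \<sigma>))"
    using filterlim_log_chart[OF w(2) r] c unfolding D filterlim_iff by blast
  have st: "\<forall>\<^sub>F s in to_origin w r. s \<in> half_strip w r"
    unfolding eventually_to_origin by blast
  show ?thesis
  proof (rule Lim_null_comparison)
    show "\<forall>\<^sub>F s in to_origin w r. norm (exp ((\<sigma> - 1) * L s) * y (log_chart a s) - lead \<sigma> J t1 t2 (exp (\<sigma> * L s)))
       \<le> norm (of_real c * exp (1 * (s + \<i> * of_real a)))"
      using ev st
    proof eventually_elim
      case (elim s)
      have im: "- pi < Im s" "Im s \<le> pi" using elim(2) w by (auto simp: half_strip_def)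
      have E: "exp ((\<sigma> - 1) * L s) * branch_pow a (log_chart a s) (1 - \<sigma>) = 1"
         "exp ((\<sigma> - 1) * L s) * branch_pow a (log_chart a s) (1 + \<sigma>) = exp (\<sigma> * L s)^2"
         "exp ((\<sigma> - 1) * L s) * log_chart a s = exp (\<sigma> * L s)"
         "exp ((\<sigma> - 1) * L s) * branch_pow a (log_chart a s) (2 - \<sigma>) = exp (L s)"
        unfolding branch_pow_log_chart[OF im] unfolding log_chart_def power2_eq_square
        by (simp_all add: mult_exp_exp L_def algebra_simps)
      have "e * q x = e * y x - (J * (e * branch_pow a x (1 - \<sigma>)) + J1_coeff \<sigma> J t1 t2 *
          (e * branch_pow a x (1 + \<sigma>)) + J2_coeff \<sigma> t1 t2 * (e * x))" for e x
        by (simp add: q_def algebra_simps)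
      from this[of "exp ((\<sigma> - 1) * L s)" "log_chart a s", unfolded E]
      have "exp ((\<sigma> - 1) * L s) * y (log_chart a s) - lead \<sigma> J t1 t2 (exp (\<sigma> * L s)) = exp ((\<sigma> - 1) * L s) * q (log_chart a s)"
        by (simp add: lead_def)
      then have "norm (exp ((\<sigma> - 1) * L s) * y (log_chart a s) - lead \<sigma> J t1 t2 (exp (\<sigma> * L s)))
          \<le> norm (exp ((\<sigma> - 1) * L s)) * (c * norm (branch_pow a (log_chart a s) (2 - \<sigma>)))"
        using elim(1) by (simp add: norm_mult mult_left_mono del: norm_exp_eq_Re)
      also have "\<dots> = c * norm (exp (L s))"
        unfolding E(4)[symmetric] by (simp add: norm_mult del: norm_exp_eq_Re)
      also have "\<dots> \<le> norm (of_real c * exp (1 * (s + \<i> * of_real a)))"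
        by (simp add: norm_mult L_def mult_right_mono)
      finally show ?case .
    qed
    have "((\<lambda>s. of_real c * exp (1 * (s + \<i> * of_real a))) \<longlongrightarrow> 0) (to_origin w r)"
      by (intro tendsto_mult_right_zero tendsto_exp_to_origin) simp
    then show "((\<lambda>s. norm (of_real c * exp (1 * (s + \<i> * of_real a)))) \<longlongrightarrow> 0) (to_origin w r)"
      by (rule tendsto_norm_zero)
  qed
qed

lemma imaginary_nonzero: "\<sigma> \<noteq> 0 \<Longrightarrow> Re \<sigma> = 0 \<Longrightarrow> Im \<sigma> \<noteq> 0 \<and> \<sigma> = \<i> * of_real (Im \<sigma>)"
  by (simp add: complex_eq_iff)

text \<open>For \<open>Re \<sigma> > 0\<close> the limit of \<open>X = x\<^sup>\<sigma>\<close> is 0, and \<open>J \<noteq> 0\<close> suffices. For \<open>Re \<sigma> = 0\<close>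
  the function \<open>X\<close> runs around a circle with period \<open>2 pi / \<bar>Im \<sigma>\<bar>\<close>; it is kept constant by moving in
  steps of one period from a starting point that avoids the zeros of two quadratic polynomials.
  The two conditions on \<open>X0\<close> keep \<open>y\<close> and \<open>y - x\<close> away from 0 relative to \<open>x\<^sup>1\<^sup>-\<^sup>\<sigma>\<close>.\<close>

lemma approach_sequence:
  fixes \<sigma> J :: complex
  assumes "0 \<le> Re \<sigma>" "\<sigma> \<noteq> 0" "J \<noteq> 0"
  obtains ts :: "nat \<Rightarrow> real" and X0 where "filterlim ts at_bot sequentially"
    "(\<lambda>n. exp (\<sigma> * (of_real (ts n) + \<i> * of_real a))) \<longlonglongrightarrow> X0"
    "lead \<sigma> J t1 t2 X0 \<noteq> 0" "lead \<sigma> J t1 t2 X0 \<noteq> X0"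
proof (cases "0 < Re \<sigma>")
  case True
  show ?thesis
  proof
    show bot: "filterlim (\<lambda>n. - real n) at_bot sequentially"
      by (simp add: filterlim_uminus_at_bot filterlim_real_sequentially)
    show "(\<lambda>n. exp (\<sigma> * (of_real (- real n) + \<i> * of_real a))) \<longlonglongrightarrow> 0"
      using filterlim_compose[OF tendsto_exp_to_origin[OF True] filterlim_compose[OF filterlim_real_to_origin[of 1 1] bot]]
      by simp
  qed (use assms in \<open>simp_all add: lead_def\<close>)
next
  case False
  with assms imaginary_nonzero[of \<sigma>] obtain \<tau> where \<tau>: "\<tau> \<noteq> 0" "\<sigma> = \<i> * of_real \<tau>" by force
  define X where "X t = exp (\<sigma> * (of_real t + \<i> * of_real a))" for t :: real
  define c1 c2 where "c1 = J2_coeff \<sigma> t1 t2" and "c2 = J1_coeff \<sigma> J t1 t2"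
  have "inj_on X {0<..<1 / \<bar>\<tau>\<bar>}"
  proof (rule inj_onI)
    fix t t' assume t: "t \<in> {0<..<1 / \<bar>\<tau>\<bar>}" "t' \<in> {0<..<1 / \<bar>\<tau>\<bar>}" and eq: "X t = X t'"
    from eq obtain n :: int where n: "\<sigma> * (of_real t + \<i> * of_real a)
        = \<sigma> * (of_real t' + \<i> * of_real a) + of_real (of_int (2 * n) * pi) * \<i>"
      unfolding X_def exp_eq by blast
    then have *: "\<tau> * (t - t') = 2 * pi * n"
      using \<tau> by (simp add: complex_eq_iff algebra_simps)
    have "\<bar>t - t'\<bar> < 1 / \<bar>\<tau>\<bar>" using t by auto
    then have "\<bar>\<tau>\<bar> * \<bar>t - t'\<bar> < 1"
      using \<tau> by (simp add: field_simps)
    then have "\<bar>2 * pi * n\<bar> < 1" unfolding *[symmetric] by (simp add: abs_mult)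
    then have "2 * pi * \<bar>real_of_int n\<bar> < 1" by (simp add: abs_mult)
    moreover have "1 * \<bar>real_of_int n\<bar> \<le> 2 * pi * \<bar>real_of_int n\<bar>"
      using pi_gt3 by (intro mult_right_mono) auto
    ultimately have "\<bar>real_of_int n\<bar> < 1" by linarith
    then have "n = 0" by linarith
    with * \<tau> show "t = t'" by simp
  qed
  then have inf: "infinite (X ` {0<..<1 / \<bar>\<tau>\<bar>})"
    using \<tau> by (subst finite_image_iff) auto
  have "finite {z. poly ([:J, c1, c2:] * [:J, c1 - 1, c2:]) z = 0}"
    using assms by (intro poly_roots_finite) auto
  with inf obtain t0 where nz: "poly ([:J, c1, c2:] * [:J, c1 - 1, c2:]) (X t0) \<noteq> 0"
    by (metis (mono_tags, lifting) finite_subset image_subsetI mem_Collect_eq)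
  have polys: "poly [:J, c1, c2:] z = lead \<sigma> J t1 t2 z" "poly [:J, c1 - 1, c2:] z = lead \<sigma> J t1 t2 z - z" for z
    by (simp_all add: lead_def c1_def c2_def algebra_simps power2_eq_square)
  have t0: "lead \<sigma> J t1 t2 (X t0) \<noteq> 0" "lead \<sigma> J t1 t2 (X t0) \<noteq> X t0"
    using nz[unfolded poly_mult polys] by auto
  define ts where "ts n = t0 - 2 * pi / \<bar>\<tau>\<bar> * real n" for n
  show ?thesis
  proof
    have "filterlim (\<lambda>n. 2 * pi / \<bar>\<tau>\<bar> * real n) at_top sequentially"
      using \<tau> by (intro filterlim_tendsto_pos_mult_at_top[OF tendsto_const] filterlim_real_sequentially) simp
    then have "filterlim (\<lambda>n. - t0 + 2 * pi / \<bar>\<tau>\<bar> * real n) at_top sequentially"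
      by (rule filterlim_tendsto_add_at_top[OF tendsto_const])
    then show "filterlim ts at_bot sequentially"
      unfolding filterlim_uminus_at_top by (simp add: ts_def[abs_def])
    have "X (ts n) = X t0" for n
    proof -
      have "\<exists>m::int. \<sigma> * (of_real (ts n) + \<i> * of_real a) = \<sigma> * (of_real t0 + \<i> * of_real a)
          + of_real (of_int (2 * m) * pi) * \<i>"
        using \<tau> by (intro exI[of _ "- (if \<tau> > 0 then 1 else -1) * int n"])
           (auto simp: ts_def complex_eq_iff field_simps)
      then show ?thesis unfolding X_def exp_eq .
    qed
    then show "(\<lambda>n. exp (\<sigma> * (of_real (ts n) + \<i> * of_real a))) \<longlonglongrightarrow> X t0"
      by (simp add: X_def)
  qed (use t0 in auto)
qed

text \<open>With \<open>g = x\<^sup>\<sigma>\<^sup>-\<^sup>1 y - lead(X)\<close> in the logarithmic coordinate, the second expression is \<open>g' - \<sigma> g\<close>.\<close>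

lemma generic_limits:
  assumes w: "0 < w" "w \<le> pi" and r: "0 < r" and D: "D = sector_at_0 a w r"
    and gen: "generic_behaviour \<sigma> J t1 t2 a D y" and hol: "y holomorphic_on D"
  defines "x \<equiv> \<lambda>t::real. log_chart a (of_real t)"
    and "X \<equiv> \<lambda>t::real. exp (\<sigma> * (of_real t + \<i> * of_real a))"
  shows "((\<lambda>t. X t * y (x t) / x t - lead \<sigma> J t1 t2 (X t)) \<longlongrightarrow> 0) at_bot"
    and "((\<lambda>t. X t * (deriv y (x t) - y (x t) / x t)
            - \<sigma> * (J1_coeff \<sigma> J t1 t2 * X t ^ 2 - J)) \<longlongrightarrow> 0) at_bot"
proof -
  define L where "L = (\<lambda>s. s + \<i> * complex_of_real a)"
  define g where "g s = exp ((\<sigma> - 1) * L s) * y (log_chart a s) - lead \<sigma> J t1 t2 (exp (\<sigma> * L s))" for s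
  have g0: "(g \<longlongrightarrow> 0) (to_origin w r)"
    using generic_remainder[OF w r D gen] by (simp add: g_def[abs_def] L_def)
  have gt: "((\<lambda>t. g (of_real t)) \<longlongrightarrow> 0) at_bot"
    by (rule filterlim_compose[OF g0 filterlim_real_to_origin[OF w(1)]])
  have X: "exp ((\<sigma> - 1) * L (of_real t)) * x t = X t" for t
    by (simp add: X_def x_def log_chart_def L_def mult_exp_exp algebra_simps)
  have x0: "x t \<noteq> 0" for t by (simp add: x_def log_chart_def)
  have X': "exp ((\<sigma> - 1) * L (of_real t)) = X t / x t" for t
    using X[of t] x0[of t] by (simp add: field_simps)
  have g_real: "g (of_real t) = X t * y (x t) / x t - lead \<sigma> J t1 t2 (X t)" for t
    unfolding g_def X' by (simp add: x_def X_def L_def)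
  show "((\<lambda>t. X t * y (x t) / x t - lead \<sigma> J t1 t2 (X t)) \<longlongrightarrow> 0) at_bot"
    using gt by (simp add: g_real)
  define dg where "dg s = (\<sigma> - 1) * exp ((\<sigma> - 1) * L s) * y (log_chart a s)
      + exp ((\<sigma> - 1) * L s) * (deriv y (log_chart a s) * log_chart a s)
      - (J2_coeff \<sigma> t1 t2 * (\<sigma> * exp (\<sigma> * L s))
         + J1_coeff \<sigma> J t1 t2 * (2 * exp (\<sigma> * L s) * (\<sigma> * exp (\<sigma> * L s))))" for s
  have deriv: "(g has_field_derivative dg s) (at s)" if s: "s \<in> half_strip w r" for s
  proof -
    have "y holomorphic_on log_chart a ` half_strip w r"
      using hol log_chart_in_sector[OF _ w(2) r] unfolding D by (auto intro: holomorphic_on_subset)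
    then have y': "(y has_field_derivative deriv y (log_chart a s)) (at (log_chart a s))"
      using open_log_chart_image[OF w(2)] s by (intro holomorphic_derivI) auto
    have "((\<lambda>s. y (log_chart a s)) has_field_derivative deriv y (log_chart a s) * log_chart a s) (at s)"
      by (rule DERIV_chain2[OF y' log_chart_has_derivative])
    then show ?thesis
      unfolding g_def[abs_def] dg_def lead_def L_def
      by (auto intro!: derivative_eq_intros simp: algebra_simps)
  qed
  then have "g holomorphic_on half_strip w r"
    by (meson field_differentiable_at_within field_differentiable_def holomorphic_onI)
  from deriv_tendsto_0_on_half_strip[OF w(1) this g0]
  have "((\<lambda>t. deriv g (of_real t) - \<sigma> * g (of_real t)) \<longlongrightarrow> 0 - \<sigma> * 0) at_bot"
    by (intro tendsto_intros gt)
  then have lim: "((\<lambda>t. deriv g (of_real t) - \<sigma> * g (of_real t)) \<longlongrightarrow> 0) at_bot" by simp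
  have "\<forall>\<^sub>F t in at_bot. complex_of_real t \<in> half_strip w r"
  proof -
    have "\<forall>\<^sub>F s in to_origin w r. s \<in> half_strip w r" unfolding eventually_to_origin by blast
    with filterlim_real_to_origin[OF w(1)] show ?thesis unfolding filterlim_iff by blast
  qed
  then have ev: "\<forall>\<^sub>F t in at_bot. deriv g (of_real t) - \<sigma> * g (of_real t)
      = X t * (deriv y (x t) - y (x t) / x t) - \<sigma> * (J1_coeff \<sigma> J t1 t2 * X t ^ 2 - J)"
  proof eventually_elim
    case (elim t)
    have "deriv g (of_real t) = dg (of_real t)" by (rule DERIV_imp_deriv[OF deriv[OF elim]])
    also have "\<dots> = (\<sigma> - 1) * (X t * y (x t) / x t) + X t * deriv y (x t)
        - (J2_coeff \<sigma> t1 t2 * (\<sigma> * X t) + J1_coeff \<sigma> J t1 t2 * (2 * X t * (\<sigma> * X t)))"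
      unfolding dg_def X' using x0[of t] by (simp add: x_def X_def L_def)
    finally show ?case
      unfolding g_real lead_def by (simp add: algebra_simps power2_eq_square diff_divide_distrib)
  qed
  show "((\<lambda>t. X t * (deriv y (x t) - y (x t) / x t)
            - \<sigma> * (J1_coeff \<sigma> J t1 t2 * X t ^ 2 - J)) \<longlongrightarrow> 0) at_bot"
    by (rule Lim_transform_eventually[OF lim ev])
qed

section \<open>Cyclic products in terms of the Painleve function\<close>

text \<open>The limit is homogeneous of degree one in \<open>\<nu>\<close>, \<open>\<eta>\<close>, \<open>X0\<close>. The terms of \<open>f\<close> that are quadratic in \<open>y\<close>
  or carry an additional factor \<open>x\<close> disappear.\<close>

lemma f_PVI_limit:
  assumes x: "x \<longlonglongrightarrow> 0" "\<And>n. x n \<noteq> 0" and y: "(\<lambda>n. y (x n)) \<longlonglongrightarrow> 0"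
    and X: "X \<longlonglongrightarrow> X0" and Y: "(\<lambda>n. X n * y (x n) / x n) \<longlonglongrightarrow> \<eta>"
    and V: "(\<lambda>n. X n * (deriv y (x n) - y (x n) / x n)) \<longlonglongrightarrow> \<nu>"
  shows "(\<lambda>n. X n * f_PVI p q t3 ti (x n) y / x n) \<longlonglongrightarrow> \<nu> + (p - q) * \<eta> - p * X0"
proof -
  have eq: "X n * f_PVI p q t3 ti (x n) y / x n = (1 - x n) * (X n * (deriv y (x n) - y (x n) / x n) + X n * y (x n) / x n)
      + (1 - ti) * y (x n) * (X n * y (x n) / x n) + ((q + ti) * x n + p - q - 1) * (X n * y (x n) / x n) - p * X n" for n
    using x(2)[of n] unfolding f_PVI_def by (simp add: divide_simps) (simp add: algebra_simps power2_eq_square)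
  have "(\<lambda>n. X n * f_PVI p q t3 ti (x n) y / x n) \<longlonglongrightarrow> (1 - 0) * (\<nu> + \<eta>) + (1 - ti) * 0 * \<eta> + ((q + ti) * 0 + p - q - 1) * \<eta> - p * X0"
    unfolding eq by (intro tendsto_intros x y X Y V)
  then show ?thesis by (simp add: algebra_simps)
qed

text \<open>Everything is written in terms of \<open>X f/x\<close> and \<open>X y/x\<close>, which have limits. The factor \<open>X\<close> on
  the left stands where \<open>X\<close>, which may tend to 0, would otherwise remain in a denominator.\<close>

lemma corresponds_products:
  assumes cor: "corresponds t1 t2 t3 ti a b G D y \<Phi>" and u: "u \<in> config_domain G D"
    and x: "xvar u = x" "x \<in> regular_points D y" "x \<noteq> 0" "x \<noteq> 1" and X: "X \<noteq> 0"
  defines "A \<equiv> \<Phi> u" and "F \<equiv> \<lambda>p q. X * f_PVI p q t3 ti x y / x" and "Y \<equiv> X * y x / x"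
  shows "A$1$2 * A$2$1 = F t1 t2 * F (- t1) (- t2) / (4 * (1 - x) * Y * (Y - X))"
    and "X * (A$1$3 * A$3$1) = F t1 (t1 - t3 - ti) * F (- t1) (- t1 + t3 - ti) / (4 * (x - 1) * (y x - 1) * Y)"
    and "X * (A$2$3 * A$3$2) = F (- t2 + t3 + ti) (- t2) * F (t2 - t3 + ti) t2 / (4 * (1 - y x) * (X - Y))"
    and "X * (A$1$3 * A$3$2 * A$2$1) = F t1 (t1 - t3 - ti) * F (t2 - t3 + ti) t2 * F (- t1) (- t2)
      / (8 * (x - 1) * (1 - y x) * Y * (Y - X))"
    and "X * (A$2$3 * A$3$1 * A$1$2) = F (- t2 + t3 + ti) (- t2) * F (- t1) (- t1 + t3 - ti) * F t1 t2
      / (8 * (y x - 1) * (1 - x) * Y * (X - Y))"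
proof -
  obtain k1 k2 where k: "exp_integral (regular_points D y) (l1_PVI t1 t2 t3 y) k1"
      "exp_integral (regular_points D y) (l2_PVI t1 t2 t3 y) k2"
    and \<Omega>: "let x = xvar u; \<Omega> = conj_pow (log_u31 a b u) (diag_part (\<Phi> u)) (\<Phi> u) in
              \<Omega>$1$2 = k1 x / k2 x * (f_PVI t1 t2 t3 ti x y / (2 * (1 - x) * y x)) \<and>
              \<Omega>$2$1 = k2 x / k1 x * (f_PVI (- t1) (- t2) t3 ti x y / (2 * (y x - x))) \<and>
              \<Omega>$1$3 = k1 x * (f_PVI t1 (t1 - t3 - ti) t3 ti x y / (2 * (x - 1) * y x)) \<and>
              \<Omega>$3$1 = 1 / k1 x *
                 (f_PVI (- t1) (- t1 + t3 - ti) t3 ti x y / (2 * x * (y x - 1))) \<and>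
              \<Omega>$2$3 = k2 x * (f_PVI (- t2 + t3 + ti) (- t2) t3 ti x y / (2 * (x - y x))) \<and>
              \<Omega>$3$2 = 1 / k2 x *
                 (f_PVI (t2 - t3 + ti) t2 t3 ti x y / (2 * x * (1 - y x)))"
    using cor u x unfolding corresponds_def by blast
  define m n p where mnp: "m = 1 - x" "n = y x - x" "p = y x - 1"
  have nz: "k1 x \<noteq> 0" "k2 x \<noteq> 0" "y x \<noteq> 0" "m \<noteq> 0" "n \<noteq> 0" "p \<noteq> 0"
    using k x by (auto simp: exp_integral_def regular_points_def mnp)
  have eqs: "1 - x = m" "x - 1 = - m" "y x - x = n" "x - y x = - n" "y x - 1 = p" "1 - y x = - p"
    by (simp_all add: mnp)
  define C where "C = conj_pow (log_u31 a b u) (diag_part (\<Phi> u)) (\<Phi> u)"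
  note pr = conj_pow_diag_products[OF C_def, folded A_def]
  note C = \<Omega>[unfolded Let_def x(1), folded C_def, unfolded eqs]
  have d: "Y - X = X * n / x" "X - Y = - (X * n / x)"
    using x by (simp_all add: Y_def mnp field_simps)
  show "A$1$2 * A$2$1 = F t1 t2 * F (- t1) (- t2) / (4 * (1 - x) * Y * (Y - X))"
    unfolding pr(2)[of 1 2, symmetric] d eqs using C X x nz by (simp add: F_def Y_def mult_ac)
  show "X * (A$1$3 * A$3$1) = F t1 (t1 - t3 - ti) * F (- t1) (- t1 + t3 - ti) / (4 * (x - 1) * (y x - 1) * Y)"
    unfolding pr(2)[of 1 3, symmetric] eqs using C X x nz by (simp add: F_def Y_def mult_ac)
  show "X * (A$2$3 * A$3$2) = F (- t2 + t3 + ti) (- t2) * F (t2 - t3 + ti) t2 / (4 * (1 - y x) * (X - Y))"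
    unfolding pr(2)[of 2 3, symmetric] d eqs using C X x nz by (simp add: F_def mult_ac)
  show "X * (A$1$3 * A$3$2 * A$2$1) = F t1 (t1 - t3 - ti) * F (t2 - t3 + ti) t2 * F (- t1) (- t2)
      / (8 * (x - 1) * (1 - y x) * Y * (Y - X))"
    unfolding pr(3)[of 1 3 2, symmetric] d eqs using C X x nz by (simp add: F_def Y_def mult_ac)
  show "X * (A$2$3 * A$3$1 * A$1$2) = F (- t2 + t3 + ti) (- t2) * F (- t1) (- t1 + t3 - ti) * F t1 t2
      / (8 * (y x - 1) * (1 - x) * Y * (X - Y))"
    unfolding pr(3)[of 2 3 1, symmetric] d eqs using C X x nz by (simp add: F_def Y_def mult_ac)
qed

text \<open>The limits of the cyclic products, combined as in \<open>qform\<close>. The quantities \<open>\<eta>\<close> and \<open>\<nu>\<close> satisfy a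
  quadratic relation (\<open>rel\<close>), which expresses \<open>\<nu>\<^sup>2\<close> by \<open>\<eta>\<close> and \<open>X\<close>, while \<open>J\<close> is linear in
  \<open>\<eta>\<close>, \<open>\<nu>\<close> and \<open>X\<close> (\<open>JJ\<close>). After clearing denominators the left-hand side is a cubic polynomial in
  \<open>\<nu>\<close>; reduced by \<open>rel\<close> it becomes linear in \<open>\<nu>\<close>, and the two coefficients can be compared with
  those of the right-hand side.\<close>

lemma f_PVI_products_algebra:
  fixes s J t1 t2 t3 ti X \<eta> \<nu> :: complex
  defines "F \<equiv> \<lambda>a b. \<nu> + (a - b) * \<eta> - a * X"
  assumes s: "s \<noteq> 0" and J: "J \<noteq> 0"
    and \<eta>: "\<eta> = J + J2_coeff s t1 t2 * X + J1_coeff s J t1 t2 * X^2"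
    and \<nu>: "\<nu> = s * (J1_coeff s J t1 t2 * X^2 - J)"
    and nz: "\<eta> \<noteq> 0" "\<eta> \<noteq> X"
  shows "F t1 t2 * F (- t1) (- t2) / (4 * \<eta> * (\<eta> - X)) = (s^2 - (t1 - t2)^2) / 4"
    and "(1 - ((t2 - t1) / s)^2) * (F t1 (t1 - t3 - ti) * F (- t1) (- t1 + t3 - ti) / (4 * \<eta>)
            - F (- t2 + t3 + ti) (- t2) * F (t2 - t3 + ti) t2 / (4 * (X - \<eta>)))
       - 2 * (t2 - t1) / s^2 *
           (- (F t1 (t1 - t3 - ti) * F (t2 - t3 + ti) t2 * F (- t1) (- t2)) / (8 * \<eta> * (\<eta> - X))
            + F (- t2 + t3 + ti) (- t2) * F (- t1) (- t1 + t3 - ti) * F t1 t2 / (8 * \<eta> * (\<eta> - X)))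
       + 2 / s *
           (- (F t1 (t1 - t3 - ti) * F (t2 - t3 + ti) t2 * F (- t1) (- t2)) / (8 * \<eta> * (\<eta> - X))
            - F (- t2 + t3 + ti) (- t2) * F (- t1) (- t1 + t3 - ti) * F t1 t2 / (8 * \<eta> * (\<eta> - X)))
       = (ti + t3 - s) * (ti - t3 - s) * J"
proof -
  have J2: "2 * s^2 * J2_coeff s t1 t2 = t1^2 - t2^2 + s^2"
    using s by (simp add: J2_coeff_def)
  have J1: "16 * s^4 * (J1_coeff s J t1 t2 * J) = (s^2 - (t1 - t2)^2) * (s^2 - (t1 + t2)^2)"
    using s J by (simp add: J1_coeff_def)
  have JJ: "4 * s^2 * J = 2 * s^2 * \<eta> - (t1^2 - t2^2 + s^2) * X - 2 * s * \<nu>"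
    unfolding J2[symmetric] \<eta> \<nu> by (simp add: algebra_simps power2_eq_square)
  have "4 * s^2 * \<nu>^2 = (2 * s^2 * \<eta> - 2 * s^2 * J2_coeff s t1 t2 * X)^2
      - 16 * s^4 * (J1_coeff s J t1 t2 * J) * X^2"
    unfolding \<eta> \<nu> by (simp add: algebra_simps power2_eq_square power4_eq_xxxx)
  then have "4 * s^2 * \<nu>^2 = (2 * s^2 * \<eta> - (t1^2 - t2^2 + s^2) * X)^2
      - (s^2 - (t1 - t2)^2) * (s^2 - (t1 + t2)^2) * X^2"
    unfolding J1 J2 .
  also have "\<dots> = 4 * s^2 * ((s^2 - (t1 - t2)^2) * \<eta> * (\<eta> - X) + ((t1 - t2) * \<eta> - t1 * X)^2)"
    by (simp add: algebra_simps power2_eq_square)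
  finally have rel: "\<nu>^2 = (s^2 - (t1 - t2)^2) * \<eta> * (\<eta> - X) + ((t1 - t2) * \<eta> - t1 * X)^2"
    using s by simp
  have "F t1 t2 * F (- t1) (- t2) = \<nu>^2 - ((t1 - t2) * \<eta> - t1 * X)^2"
    by (simp add: F_def algebra_simps power2_eq_square)
  then show "F t1 t2 * F (- t1) (- t2) / (4 * \<eta> * (\<eta> - X)) = (s^2 - (t1 - t2)^2) / 4"
    unfolding rel using nz by simp
  define P13 P23 Q Q' where P: "P13 = F t1 (t1 - t3 - ti) * F (- t1) (- t1 + t3 - ti)"
    "P23 = F (- t2 + t3 + ti) (- t2) * F (t2 - t3 + ti) t2"
    "Q = F t1 (t1 - t3 - ti) * F (t2 - t3 + ti) t2 * F (- t1) (- t2)"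
    "Q' = F (- t2 + t3 + ti) (- t2) * F (- t1) (- t1 + t3 - ti) * F t1 t2"
  \<comment> \<open>Each \<open>F\<close> is \<open>\<nu>\<close> plus a form in \<open>\<eta>\<close> and \<open>X\<close>; \<open>W\<close> is the value of \<open>\<nu>\<^sup>2\<close>.\<close>
  define \<alpha> \<beta> \<gamma> \<delta> \<rho> W R where c: "\<alpha> = (ti + t3) * \<eta> - t1 * X" "\<beta> = (ti - t3) * \<eta> + t1 * X"
    "\<gamma> = (ti + t3) * \<eta> - (ti + t3 - t2) * X" "\<delta> = (ti - t3) * \<eta> - (ti - t3 + t2) * X"
    "\<rho> = (t1 - t2) * \<eta> - t1 * X" "W = (s^2 - (t1 - t2)^2) * \<eta> * (\<eta> - X) + \<rho>^2"
    "R = \<eta> * (\<eta> - X) * ((ti + t3 - s) * (ti - t3 - s))"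
  have W: "\<nu>^2 = W" using rel by (simp add: c)
  have F: "F t1 (t1 - t3 - ti) = \<nu> + \<alpha>" "F (- t1) (- t1 + t3 - ti) = \<nu> + \<beta>"
    "F (- t2 + t3 + ti) (- t2) = \<nu> + \<gamma>" "F (t2 - t3 + ti) t2 = \<nu> + \<delta>"
    "F (- t1) (- t2) = \<nu> - \<rho>" "F t1 t2 = \<nu> + \<rho>"
    by (simp_all add: F_def c algebra_simps)
  have P': "P13 = \<nu>^2 + (\<alpha> + \<beta>) * \<nu> + \<alpha> * \<beta>" "P23 = \<nu>^2 + (\<gamma> + \<delta>) * \<nu> + \<gamma> * \<delta>"
    "Q = (\<nu>^2 + \<alpha> * \<delta> - \<rho> * (\<alpha> + \<delta>)) * \<nu> + (\<alpha> + \<delta> - \<rho>) * \<nu>^2 - \<alpha> * \<delta> * \<rho>"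
    "Q' = (\<nu>^2 + \<gamma> * \<beta> + \<rho> * (\<gamma> + \<beta>)) * \<nu> + (\<gamma> + \<beta> + \<rho>) * \<nu>^2 + \<gamma> * \<beta> * \<rho>"
    unfolding P F by (simp_all add: algebra_simps power2_eq_square)
  \<comment> \<open>Coefficient of \<open>\<nu>\<close> after the reduction.\<close>
  have E1: "2 * (s^2 - (t1 - t2)^2) * ((\<alpha> + \<beta>) * (\<eta> - X) + (\<gamma> + \<delta>) * \<eta>)
      - 2 * (t2 - t1) * (\<gamma> * \<beta> + \<rho> * (\<gamma> + \<beta>) - \<alpha> * \<delta> + \<rho> * (\<alpha> + \<delta>))
      - 2 * s * (2 * W + \<alpha> * \<delta> - \<rho> * (\<alpha> + \<delta>) + \<gamma> * \<beta> + \<rho> * (\<gamma> + \<beta>)) = - (4 * s * R)"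
    unfolding c by (simp add: algebra_simps power2_eq_square)
  \<comment> \<open>Constant coefficient after the reduction.\<close>
  have E0: "2 * (s^2 - (t1 - t2)^2) * ((W + \<alpha> * \<beta>) * (\<eta> - X) + (W + \<gamma> * \<delta>) * \<eta>)
      - 2 * (t2 - t1) * ((\<gamma> + \<beta> - \<alpha> - \<delta> + 2 * \<rho>) * W + \<gamma> * \<beta> * \<rho> + \<alpha> * \<delta> * \<rho>)
      - 2 * s * ((\<alpha> + \<delta> + \<gamma> + \<beta>) * W - \<alpha> * \<delta> * \<rho> + \<gamma> * \<beta> * \<rho>)
      = 2 * (2 * s^2 * \<eta> - (t1^2 - t2^2 + s^2) * X) * R"
    unfolding c by (simp add: algebra_simps power2_eq_square)
  have "2 * (s^2 - (t1 - t2)^2) * (P13 * (\<eta> - X) + P23 * \<eta>) - 2 * (t2 - t1) * (Q' - Q) - 2 * s * (Q + Q')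
    = (2 * (s^2 - (t1 - t2)^2) * ((W + \<alpha> * \<beta>) * (\<eta> - X) + (W + \<gamma> * \<delta>) * \<eta>)
      - 2 * (t2 - t1) * ((\<gamma> + \<beta> - \<alpha> - \<delta> + 2 * \<rho>) * W + \<gamma> * \<beta> * \<rho> + \<alpha> * \<delta> * \<rho>)
      - 2 * s * ((\<alpha> + \<delta> + \<gamma> + \<beta>) * W - \<alpha> * \<delta> * \<rho> + \<gamma> * \<beta> * \<rho>))
    + \<nu> * (2 * (s^2 - (t1 - t2)^2) * ((\<alpha> + \<beta>) * (\<eta> - X) + (\<gamma> + \<delta>) * \<eta>)
      - 2 * (t2 - t1) * (\<gamma> * \<beta> + \<rho> * (\<gamma> + \<beta>) - \<alpha> * \<delta> + \<rho> * (\<alpha> + \<delta>))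
      - 2 * s * (2 * W + \<alpha> * \<delta> - \<rho> * (\<alpha> + \<delta>) + \<gamma> * \<beta> + \<rho> * (\<gamma> + \<beta>)))"
    unfolding P' W by (simp add: algebra_simps)
  also have "\<dots> = 2 * (4 * s^2 * J) * R"
    unfolding E0 E1 JJ by (simp add: algebra_simps)
  finally have main: "2 * (s^2 - (t1 - t2)^2) * (P13 * (\<eta> - X) + P23 * \<eta>) - 2 * (t2 - t1) * (Q' - Q)
      - 2 * s * (Q + Q') = 2 * (4 * s^2 * J) * R" .
  define H where "H = 8 * s^2 * \<eta> * (\<eta> - X)"
  have H: "H \<noteq> 0" using s nz by (simp add: H_def)
  show "(1 - ((t2 - t1) / s)^2) * (F t1 (t1 - t3 - ti) * F (- t1) (- t1 + t3 - ti) / (4 * \<eta>)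
            - F (- t2 + t3 + ti) (- t2) * F (t2 - t3 + ti) t2 / (4 * (X - \<eta>)))
       - 2 * (t2 - t1) / s^2 *
           (- (F t1 (t1 - t3 - ti) * F (t2 - t3 + ti) t2 * F (- t1) (- t2)) / (8 * \<eta> * (\<eta> - X))
            + F (- t2 + t3 + ti) (- t2) * F (- t1) (- t1 + t3 - ti) * F t1 t2 / (8 * \<eta> * (\<eta> - X)))
       + 2 / s *
           (- (F t1 (t1 - t3 - ti) * F (t2 - t3 + ti) t2 * F (- t1) (- t2)) / (8 * \<eta> * (\<eta> - X))
            - F (- t2 + t3 + ti) (- t2) * F (- t1) (- t1 + t3 - ti) * F t1 t2 / (8 * \<eta> * (\<eta> - X)))
       = (ti + t3 - s) * (ti - t3 - s) * J"
    (is "?L = ?R")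
  proof -
    have "P13 / (4 * \<eta>) - P23 / (4 * (X - \<eta>)) = 2 * s^2 * (P13 * (\<eta> - X) + P23 * \<eta>) / H"
      using s nz by (simp add: H_def divide_simps) (simp add: algebra_simps)
    moreover have "- Q / (8 * \<eta> * (\<eta> - X)) + Q' / (8 * \<eta> * (\<eta> - X)) = s^2 * (Q' - Q) / H"
      "- Q / (8 * \<eta> * (\<eta> - X)) - Q' / (8 * \<eta> * (\<eta> - X)) = - (s^2 * (Q + Q')) / H"
      using s nz by (simp_all add: H_def divide_simps)
    ultimately have "?L = (1 - ((t2 - t1) / s)^2) * (2 * s^2 * (P13 * (\<eta> - X) + P23 * \<eta>) / H)
        - 2 * (t2 - t1) / s^2 * (s^2 * (Q' - Q) / H) + 2 / s * (- (s^2 * (Q + Q')) / H)"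
      unfolding P[symmetric] by simp
    also have "\<dots> = (2 * (s^2 - (t1 - t2)^2) * (P13 * (\<eta> - X) + P23 * \<eta>) - 2 * (t2 - t1) * (Q' - Q)
      - 2 * s * (Q + Q')) / H"
      using s H by (simp add: divide_simps) (simp add: algebra_simps power2_eq_square)
    also have "\<dots> = ?R"
      unfolding main using s nz by (simp add: H_def c)
    finally show ?thesis .
  qed
qed

text \<open>The premises are \<open>det = 0\<close> and the value of the sum of the principal minors of a matrix with
  diagonal \<open>- t1\<close>, \<open>- t2\<close>, \<open>- t3\<close>, with \<open>q\<close> and \<open>q'\<close> the two products along 3-cycles. They remove
  \<open>q + q'\<close> from \<open>qform\<close>, and then \<open>p13 - p23\<close> from the terms with \<open>s\<^sup>2\<close> in the denominator.\<close>

lemma qform_J_identity: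
  fixes s t1 t2 t3 ti p12 p13 p23 q q' :: complex
  assumes s: "s \<noteq> 0" "s^2 = (t1 - t2)^2 + 4 * p12"
    and det: "q + q' = t1 * t2 * t3 - t1 * p23 - t2 * p13 - t3 * p12"
    and ti: "ti^2 = 4 * (p12 + p23 + p13) + t1^2 + t2^2 + t3^2 - 2 * (t1 * t2 + t2 * t3 + t1 * t3)"
  shows "(1 - ((t2 - t1) / s)^2) * (p13 - p23) - 2 * (t2 - t1) / s^2 * (q + q') + 2 / s * (q - q')
    = (p13 - p23) + (t1 - t2) * (t1 + t2 - 2 * t3) / 4 + 2 / s * (q - q')
      + (t1^2 - t2^2) * (t3^2 - ti^2) / (4 * s^2)"
proof -
  have "s^2 * ((t1 - t2) * (t1 + t2 - 2 * t3)) + (t1^2 - t2^2) * (t3^2 - ti^2)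
    = - 4 * (t2 - t1)^2 * (p13 - p23) - 8 * (t2 - t1) * (q + q')"
    unfolding s(2) det ti by (simp add: algebra_simps power2_eq_square)
  then have quot: "(s^2 * ((t1 - t2) * (t1 + t2 - 2 * t3)) + (t1^2 - t2^2) * (t3^2 - ti^2)) / (4 * s^2)
    = (- 4 * (t2 - t1)^2 * (p13 - p23) - 8 * (t2 - t1) * (q + q')) / (4 * s^2)"
    by simp
  have "(t1 - t2) * (t1 + t2 - 2 * t3) / 4 + (t1^2 - t2^2) * (t3^2 - ti^2) / (4 * s^2)
    = - (((t2 - t1) / s)^2) * (p13 - p23) - 2 * (t2 - t1) / s^2 * (q + q')"
  proof -
    have "(- 4 * h^2 * P - 8 * h * S) / (4 * s^2) = - ((h / s)^2) * P - 2 * h / s^2 * S" for h P S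
      using s(1) by (simp add: field_simps power2_eq_square)
    moreover have "(s^2 * P + S) / (4 * s^2) = P / 4 + S / (4 * s^2)" for P S
      using s(1) by (simp add: add_divide_distrib)
    ultimately show ?thesis using quot by metis
  qed
  then show ?thesis by (simp add: algebra_simps)
qed

section \<open>The parameters of the solution in terms of the boundary value\<close>

text \<open>A configuration with \<open>u\<^sub>1 = 0\<close> and with \<open>u\<^sub>2\<close> in the central direction of its sector, over a given
  value of \<open>x\<close>.\<close>

lemma probe_point:
  assumes x: "x \<in> sector_at_0 a w r" "r \<le> 1" and v: "0 < v"
    and u_def: "u = (vector [0, cis b, cis b / x] :: complex^3)"
  shows "u \<in> config_domain (sector b v) (sector_at_0 a w r)" "xvar u = x" "cis b \<in> sector b v"
proof -
  have x0: "x \<noteq> 0" "x \<noteq> 1" using x by (auto simp: sector_at_0_def sector_def)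
  show xv: "xvar u = x" using x0 by (simp add: xvar_def u_def)
  have "branch_log b (cis b) = \<i> * of_real b"
    by (simp add: branch_log_def cis_mult)
  then show s: "cis b \<in> sector b v" using v by (simp add: sector_def)
  show "u \<in> config_domain (sector b v) (sector_at_0 a w r)"
    using x x0 xv s by (simp add: config_domain_def) (simp add: u_def field_simps)
qed

theorem corollary1p6:
  fixes \<theta>1 \<theta>2 \<theta>3 \<theta>inf \<sigma> J s :: complex
    and a w r b v :: real
    and y :: "complex \<Rightarrow> complex"
    and \<Phi> :: "complex^3 \<Rightarrow> complex^3^3"
    and \<Phi>0 :: "complex^3^3"
    and \<phi> :: "3 \<Rightarrow> 3 \<Rightarrow> complex"
    and D G :: "complex set"
  assumes "D = sector_at_0 a w r"
    and "G = sector b v"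
    and "\<And>i j. \<phi> i j = \<Phi>0 $ i $ j"
    and "0 < w" "w \<le> pi" "0 < r" "r \<le> 1" "0 < v" "v \<le> pi"
    and "\<sigma> \<noteq> 0" "J \<noteq> 0"
    and "generic_PVI_solution \<sigma> J \<theta>1 \<theta>2 \<theta>3 \<theta>inf a D y"
    and "s = 1 \<or> s = -1"
    and "isomonodromy_solution s (config_domain G D) \<Phi>"
    and "in_PVI_class \<theta>1 \<theta>2 \<theta>3 \<theta>inf (config_domain G D) \<Phi>"
    and "corresponds \<theta>1 \<theta>2 \<theta>3 \<theta>inf a b G D y \<Phi>"
    and "is_boundary_value a b G D \<Phi> \<Phi>0"
  shows "\<theta>1 = - \<phi> 1 1 \<and> \<theta>2 = - \<phi> 2 2 \<and> \<theta>3 = - \<phi> 3 3 \<and>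
         \<sigma>^2 = (\<phi> 1 1 - \<phi> 2 2)^2 + 4 * \<phi> 1 2 * \<phi> 2 1 \<and>
         \<theta>inf^2 = 4 * (\<phi> 1 2 * \<phi> 2 1 + \<phi> 2 3 * \<phi> 3 2 + \<phi> 3 1 * \<phi> 1 3)
           + \<theta>1^2 + \<theta>2^2 + \<theta>3^2 - 2 * (\<theta>1 * \<theta>2 + \<theta>2 * \<theta>3 + \<theta>1 * \<theta>3) \<and>
         (\<theta>inf + \<theta>3 - \<sigma>) * (\<theta>inf - \<theta>3 - \<sigma>) * J =
           (\<phi> 1 3 * \<phi> 3 1 - \<phi> 3 2 * \<phi> 2 3)
           + (\<phi> 2 2 - \<phi> 1 1) * (2 * \<phi> 3 3 - \<phi> 1 1 - \<phi> 2 2) / 4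
           + 2 / \<sigma> * (\<phi> 1 3 * \<phi> 3 2 * \<phi> 2 1 - \<phi> 2 3 * \<phi> 3 1 * \<phi> 1 2)
           + (\<theta>1^2 - \<theta>2^2) * (\<theta>3^2 - \<theta>inf^2) / (4 * \<sigma>^2)"
proof -
  define xs where "xs = (\<lambda>t::real. log_chart a (of_real t))"
  define Xs where "Xs = (\<lambda>t::real. exp (\<sigma> * (of_real t + \<i> * of_real a)))"
  note D = assms(1) and G = assms(2) and w = assms(4,5) and r = assms(6,7) and v = assms(8)
    and \<sigma> = assms(10) and J = assms(11)
  have hol: "y holomorphic_on D" and gen: "generic_behaviour \<sigma> J \<theta>1 \<theta>2 a D y"
    using assms(12) by (auto simp: generic_PVI_solution_def PVI_solution_def)
  have Re\<sigma>: "0 \<le> Re \<sigma>" "Re \<sigma> < 1" using gen by (auto simp: generic_behaviour_def)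
  obtain ts X0 where ts: "filterlim ts at_bot sequentially" and X0: "(\<lambda>n. Xs (ts n)) \<longlonglongrightarrow> X0"
    and nz: "lead \<sigma> J \<theta>1 \<theta>2 X0 \<noteq> 0" "lead \<sigma> J \<theta>1 \<theta>2 X0 \<noteq> X0"
    using approach_sequence[OF Re\<sigma>(1) \<sigma> J] unfolding Xs_def by metis
  define x where "x n = xs (ts n)" for n
  define X where "X n = Xs (ts n)" for n
  define Y where "Y n = X n * y (x n) / x n" for n
  define V where "V n = X n * (deriv y (x n) - y (x n) / x n)" for n
  define \<eta> \<nu> where "\<eta> = lead \<sigma> J \<theta>1 \<theta>2 X0" and "\<nu> = \<sigma> * (J1_coeff \<sigma> J \<theta>1 \<theta>2 * X0^2 - J)"
  have X: "X \<longlonglongrightarrow> X0" using X0 by (simp add: X_def[abs_def])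
  have x0: "x n \<noteq> 0" and Xnz: "X n \<noteq> 0" for n by (simp_all add: x_def xs_def log_chart_def X_def Xs_def)
  note lims = generic_limits[OF w r(1) D gen hol, folded xs_def Xs_def]
  have Y: "Y \<longlonglongrightarrow> \<eta>"
  proof -
    have "(\<lambda>n. Y n - lead \<sigma> J \<theta>1 \<theta>2 (X n)) \<longlonglongrightarrow> 0"
      using filterlim_compose[OF lims(1) ts] by (simp add: Y_def x_def X_def xs_def Xs_def)
    moreover have "(\<lambda>n. lead \<sigma> J \<theta>1 \<theta>2 (X n)) \<longlonglongrightarrow> \<eta>"
      unfolding lead_def \<eta>_def by (intro tendsto_intros X)
    ultimately show ?thesis using tendsto_add by fastforce
  qed
  have V: "V \<longlonglongrightarrow> \<nu>"
  proof -
    have "(\<lambda>n. V n - \<sigma> * (J1_coeff \<sigma> J \<theta>1 \<theta>2 * X n ^ 2 - J)) \<longlonglongrightarrow> 0"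
      using filterlim_compose[OF lims(2) ts] by (simp add: V_def x_def X_def xs_def Xs_def)
    moreover have "(\<lambda>n. \<sigma> * (J1_coeff \<sigma> J \<theta>1 \<theta>2 * X n ^ 2 - J)) \<longlonglongrightarrow> \<nu>"
      unfolding \<nu>_def by (intro tendsto_intros X)
    ultimately show ?thesis using tendsto_add by fastforce
  qed
  have orig: "filterlim (\<lambda>n. complex_of_real (ts n)) (to_origin w r) sequentially"
    by (rule filterlim_compose[OF filterlim_real_to_origin[OF w(1)] ts])
  have xlim: "filterlim x (at 0 within D) sequentially"
    using filterlim_compose[OF filterlim_log_chart[OF w(2) r(1)] orig] by (simp add: x_def[abs_def] xs_def D)
  then have xt: "x \<longlonglongrightarrow> 0" and xD: "\<forall>\<^sub>F n in sequentially. x n \<in> D"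
    unfolding filterlim_at by (auto elim: eventually_mono)
  have yt: "(\<lambda>n. y (x n)) \<longlonglongrightarrow> 0"
  proof -
    have "(\<lambda>n. exp ((1 - \<sigma>) * (of_real (ts n) + \<i> * of_real a))) \<longlonglongrightarrow> 0"
      using Re\<sigma>(2) by (intro filterlim_compose[OF tendsto_exp_to_origin orig]) simp
    moreover have "exp ((1 - \<sigma>) * (of_real (ts n) + \<i> * of_real a)) = x n / X n" for n
      by (simp add: x_def xs_def log_chart_def X_def Xs_def exp_diff[symmetric] algebra_simps)
    ultimately have "(\<lambda>n. x n / X n * Y n) \<longlonglongrightarrow> 0 * \<eta>"
      by (intro tendsto_mult Y) simp
    then show ?thesis using x0 Xnz by (simp add: Y_def)
  qed
  \<comment> \<open>The conditions on \<open>X0\<close> make \<open>y\<close> and \<open>y - x\<close> nonzero, and \<open>y\<close> tends to 0, so the formulas of the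
  correspondence are available.\<close>
  have reg: "\<forall>\<^sub>F n in sequentially. x n \<in> regular_points D y"
  proof -
    have "(\<lambda>n. Y n - X n) \<longlonglongrightarrow> \<eta> - X0" by (intro tendsto_intros Y X)
    then have "\<forall>\<^sub>F n in sequentially. Y n - X n \<noteq> 0"
      by (rule tendsto_imp_eventually_ne) (use nz in \<open>auto simp: \<eta>_def\<close>)
    moreover have "\<forall>\<^sub>F n in sequentially. Y n \<noteq> 0"
      using nz by (intro tendsto_imp_eventually_ne[OF Y]) (auto simp: \<eta>_def)
    moreover have "\<forall>\<^sub>F n in sequentially. y (x n) \<noteq> 1"
      by (intro tendsto_imp_eventually_ne[OF yt]) simp
    ultimately show ?thesis using xD
      by eventually_elim (use x0 in \<open>auto simp: regular_points_def Y_def\<close>)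
  qed
  define F where "F p q n = X n * f_PVI p q \<theta>3 \<theta>inf (x n) y / x n" for p q n
  define F0 where "F0 p q = \<nu> + (p - q) * \<eta> - p * X0" for p q
  have F: "F p q \<longlonglongrightarrow> F0 p q" for p q
    unfolding F_def[abs_def] F0_def
    using f_PVI_limit[OF xt x0 yt X] Y V unfolding Y_def[abs_def] V_def[abs_def] by blast

  \<comment> \<open>With \<open>u\<^sub>1\<close> and \<open>u\<^sub>2\<close> fixed, \<open>x\<close> tends to 0 exactly when \<open>u\<^sub>3\<close> tends to infinity.\<close>
  define u where "u n = (vector [0, cis b, cis b / x n] :: complex^3)" for n
  define \<Phi>s where "\<Phi>s n = \<Phi> (u n)" for n
  have u: "\<forall>\<^sub>F n in sequentially. u n \<in> config_domain G D \<and> xvar (u n) = x n"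
    using xD by eventually_elim (use probe_point(1,2)[OF _ r(2) v refl, where a = a and w = w and b = b] in \<open>simp add: D G u_def\<close>)
  have bG: "cis b \<in> G"
    using xD probe_point(3)[OF _ r(2) v refl, where a = a and w = w and b = b] unfolding D G
    by (meson eventually_happens sequentially_bot)
  have u3: "filterlim (\<lambda>n. cis b / x n) (u3_to_inf G D 0 (cis b)) sequentially"
    unfolding u3_to_inf_def filterlim_inf filterlim_principal
  proof
    have "filterlim x (at 0) sequentially"
      using xt x0 by (simp add: filterlim_at)
    then show "filterlim (\<lambda>n. cis b / x n) at_infinity sequentially"
      unfolding divide_inverse
      by (intro tendsto_mult_filterlim_at_infinity[OF tendsto_const]
          filterlim_compose[OF filterlim_inverse_at_infinity]) auto
    show "\<forall>\<^sub>F n in sequentially. cis b / x n \<in> {u3. vector [0, cis b, u3] \<in> config_domain G D}"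
      using u by eventually_elim (simp add: u_def)
  qed
  obtain \<Phi>2 where \<Phi>2: "\<forall>u1 u2. u2 - u1 \<in> G \<longrightarrow>
          ((\<lambda>u3. delta_part 2 (\<Phi> (vector [u1, u2, u3]))) \<longlongrightarrow> delta_part 2 (\<Phi>2 u1 u2))
            (u3_to_inf G D u1 u2) \<and>
          ((\<lambda>u3. conj_pow (log_ratio a (vector [u1, u2, u3])) (delta_part 2 (\<Phi>2 u1 u2))
                   (\<Phi> (vector [u1, u2, u3]))) \<longlongrightarrow> \<Phi>2 u1 u2)
            (u3_to_inf G D u1 u2) \<and>
          conj_pow (branch_log b (u2 - u1)) (delta_part 1 \<Phi>0) (\<Phi>2 u1 u2) = \<Phi>0"
    using assms(17) unfolding is_boundary_value_def by blast
  define A where "A = \<Phi>2 0 (cis b)"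
  define l where "l n = log_ratio a (u n)" for n
  have "cis b - 0 \<in> G" using bG by simp
  note bv = \<Phi>2[rule_format, OF this, folded A_def]
  have lim1: "(\<lambda>n. delta_part 2 (\<Phi>s n)) \<longlonglongrightarrow> delta_part 2 A"
    using filterlim_compose[OF bv[THEN conjunct1] u3] by (simp add: \<Phi>s_def u_def)
  have lim2: "(\<lambda>n. conj_pow (l n) (delta_part 2 A) (\<Phi>s n)) \<longlonglongrightarrow> A"
    using filterlim_compose[OF bv[THEN conjunct2, THEN conjunct1] u3] by (simp add: \<Phi>s_def u_def l_def)
  have \<Phi>0: "\<Phi>0 = conj_pow (branch_log b (cis b - 0)) (diag_part \<Phi>0) A"
    by (rule bv[THEN conjunct2, THEN conjunct2, unfolded delta_part_1, symmetric])
  note pr = conj_pow_diag_products[OF \<Phi>0]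

  have cls: "\<forall>\<^sub>F n in sequentially. diag_part (\<Phi>s n) = - diag3 \<theta>1 \<theta>2 \<theta>3 \<and>
      eigenvals (\<Phi>s n) = {0, (\<theta>inf - \<theta>1 - \<theta>2 - \<theta>3) / 2, (- \<theta>inf - \<theta>1 - \<theta>2 - \<theta>3) / 2}"
    using u assms(15) by (auto simp: in_PVI_class_def \<Phi>s_def elim: eventually_mono)
  have diag: "\<forall>\<^sub>F n in sequentially. \<Phi>s n $ i $ i = - diag3 \<theta>1 \<theta>2 \<theta>3 $ i $ i" for i
    using cls
  proof eventually_elim
    case (elim n)
    then have "diag_part (\<Phi>s n) $ i $ i = (- diag3 \<theta>1 \<theta>2 \<theta>3) $ i $ i" by simp
    then show ?case by (simp add: diag_part_def)
  qed
  have Adiag: "A $ i $ i = - diag3 \<theta>1 \<theta>2 \<theta>3 $ i $ i" for i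
  proof -
    have "(\<lambda>n. delta_part 2 (\<Phi>s n) $ i $ i) \<longlonglongrightarrow> delta_part 2 A $ i $ i"
      by (intro tendsto_vec_nth lim1)
    then have "(\<lambda>n. \<Phi>s n $ i $ i) \<longlonglongrightarrow> A $ i $ i" by (simp add: delta_part_2_nth_diag)
    moreover have "(\<lambda>n. \<Phi>s n $ i $ i) \<longlonglongrightarrow> - diag3 \<theta>1 \<theta>2 \<theta>3 $ i $ i"
      by (rule tendsto_eventually[OF diag])
    ultimately show ?thesis by (rule LIMSEQ_unique)
  qed
  have d: "A$1$1 = - \<theta>1" "A$2$2 = - \<theta>2" "A$3$3 = - \<theta>3"
    unfolding Adiag by (simp_all add: diag3_def)
  have good: "\<forall>\<^sub>F n in sequentially. u n \<in> config_domain G D \<and> xvar (u n) = x n \<and>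
      x n \<in> regular_points D y \<and> x n \<noteq> 1"
  proof -
    have "\<forall>\<^sub>F n in sequentially. x n \<noteq> 1"
      by (rule tendsto_imp_eventually_ne[OF xt]) simp
    with u reg show ?thesis by eventually_elim auto
  qed
  note prods = corresponds_products[OF assms(16), where u = "u n" and x = "x n" and X = "X n" for n,
      folded F_def \<Phi>s_def Y_def]
  have \<eta>nz: "\<eta> \<noteq> 0" "\<eta> \<noteq> X0" "\<eta> - X0 \<noteq> 0" "X0 - \<eta> \<noteq> 0" using nz by (auto simp: \<eta>_def)
  note alg = f_PVI_products_algebra[OF \<sigma> J \<eta>_def[unfolded lead_def] \<nu>_def \<eta>nz(1,2), folded F0_def]

  have p12: "A$1$2 * A$2$1 = (\<sigma>^2 - (\<theta>1 - \<theta>2)^2) / 4"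
  proof -
    have entry: "delta_part 2 Z $ 1 $ 2 = Z $ 1 $ 2" "delta_part 2 Z $ 2 $ 1 = Z $ 2 $ 1" for Z
      by (simp_all add: delta_part_def idx_def)
    have "(\<lambda>n. delta_part 2 (\<Phi>s n) $ 1 $ 2 * delta_part 2 (\<Phi>s n) $ 2 $ 1) \<longlonglongrightarrow>
        delta_part 2 A $ 1 $ 2 * delta_part 2 A $ 2 $ 1"
      by (intro tendsto_mult tendsto_vec_nth lim1)
    then have L1: "(\<lambda>n. \<Phi>s n $ 1 $ 2 * \<Phi>s n $ 2 $ 1) \<longlonglongrightarrow> A$1$2 * A$2$1"
      by (simp add: entry)
    have L2: "(\<lambda>n. F \<theta>1 \<theta>2 n * F (- \<theta>1) (- \<theta>2) n / (4 * (1 - x n) * Y n * (Y n - X n))) \<longlonglongrightarrow>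
        F0 \<theta>1 \<theta>2 * F0 (- \<theta>1) (- \<theta>2) / (4 * (1 - 0) * \<eta> * (\<eta> - X0))"
      by (intro tendsto_intros F xt X Y) (use \<eta>nz in auto)
    have L3: "\<forall>\<^sub>F n in sequentially. F \<theta>1 \<theta>2 n * F (- \<theta>1) (- \<theta>2) n / (4 * (1 - x n) * Y n * (Y n - X n))
        = \<Phi>s n $ 1 $ 2 * \<Phi>s n $ 2 $ 1"
      using good
    proof eventually_elim
      case (elim n)
      then show ?case using prods(1)[of n, symmetric] x0 Xnz by blast
    qed
    have "A$1$2 * A$2$1 = F0 \<theta>1 \<theta>2 * F0 (- \<theta>1) (- \<theta>2) / (4 * (1 - 0) * \<eta> * (\<eta> - X0))"
      by (rule LIMSEQ_unique[OF L1 Lim_transform_eventually[OF L2 L3]])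
    then show ?thesis using alg(1) by simp
  qed
  have \<sigma>2: "\<sigma>^2 = (A$1$1 - A$2$2)^2 + 4 * A$1$2 * A$2$1"
    using p12 by (simp add: d mult.assoc power2_eq_square algebra_simps)
  \<comment> \<open>Here the branches match: \<open>log ((u\<^sub>3 - u\<^sub>2)/(u\<^sub>2 - u\<^sub>1)) = log (1 - x) - log x\<close> with the branch of
  \<open>log x\<close> that defines \<open>X = x\<^sup>\<sigma>\<close>.\<close>
  have Xl: "(\<lambda>n. X n * exp (\<sigma> * l n)) \<longlonglongrightarrow> 1"
  proof -
    have "(\<lambda>n. exp (\<sigma> * Ln (1 - x n))) \<longlonglongrightarrow> exp (\<sigma> * Ln (1 - 0))"
      by (intro tendsto_intros xt) simp
    moreover have "\<forall>\<^sub>F n in sequentially. exp (\<sigma> * Ln (1 - x n)) = X n * exp (\<sigma> * l n)"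
      using u
    proof eventually_elim
      case (elim n)
      have "branch_log a (x n) = of_real (ts n) + \<i> * of_real a"
        unfolding x_def xs_def by (rule branch_log_log_chart) auto
      with elim show ?case
        by (simp add: l_def log_ratio_def X_def Xs_def mult_exp_exp algebra_simps)
    qed
    ultimately show ?thesis by (simp add: Lim_transform_eventually)
  qed
  have q1: "(\<lambda>n. X n * qform \<sigma> (\<Phi>s n) (outer_block (\<Phi>s n))) \<longlonglongrightarrow> qform \<sigma> A (outer_block A)"
    by (rule qform_limit[OF sequentially_bot \<sigma> \<sigma>2 lim1 lim2 X Xl])
  define P13 where "P13 n = F \<theta>1 (\<theta>1 - \<theta>3 - \<theta>inf) n * F (- \<theta>1) (- \<theta>1 + \<theta>3 - \<theta>inf) n / (4 * (x n - 1) * (y (x n) - 1) * Y n)" for n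
  define P23 where "P23 n = F (- \<theta>2 + \<theta>3 + \<theta>inf) (- \<theta>2) n * F (\<theta>2 - \<theta>3 + \<theta>inf) \<theta>2 n / (4 * (1 - y (x n)) * (X n - Y n))" for n
  define Q where "Q n = F \<theta>1 (\<theta>1 - \<theta>3 - \<theta>inf) n * F (\<theta>2 - \<theta>3 + \<theta>inf) \<theta>2 n * F (- \<theta>1) (- \<theta>2) n
      / (8 * (x n - 1) * (1 - y (x n)) * Y n * (Y n - X n))" for n
  define Q' where "Q' n = F (- \<theta>2 + \<theta>3 + \<theta>inf) (- \<theta>2) n * F (- \<theta>1) (- \<theta>1 + \<theta>3 - \<theta>inf) n * F \<theta>1 \<theta>2 n
      / (8 * (y (x n) - 1) * (1 - x n) * Y n * (X n - Y n))" for n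
  have P13: "P13 \<longlonglongrightarrow> F0 \<theta>1 (\<theta>1 - \<theta>3 - \<theta>inf) * F0 (- \<theta>1) (- \<theta>1 + \<theta>3 - \<theta>inf) / (4 * (0 - 1) * (0 - 1) * \<eta>)"
    unfolding P13_def[abs_def] by (intro tendsto_intros F xt yt X Y) (use \<eta>nz in auto)
  have P23: "P23 \<longlonglongrightarrow> F0 (- \<theta>2 + \<theta>3 + \<theta>inf) (- \<theta>2) * F0 (\<theta>2 - \<theta>3 + \<theta>inf) \<theta>2 / (4 * (1 - 0) * (X0 - \<eta>))"
    unfolding P23_def[abs_def] by (intro tendsto_intros F xt yt X Y) (use \<eta>nz in auto)
  have Q: "Q \<longlonglongrightarrow> F0 \<theta>1 (\<theta>1 - \<theta>3 - \<theta>inf) * F0 (\<theta>2 - \<theta>3 + \<theta>inf) \<theta>2 * F0 (- \<theta>1) (- \<theta>2)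
      / (8 * (0 - 1) * (1 - 0) * \<eta> * (\<eta> - X0))"
    unfolding Q_def[abs_def] by (intro tendsto_intros F xt yt X Y) (use \<eta>nz in auto)
  have Q': "Q' \<longlonglongrightarrow> F0 (- \<theta>2 + \<theta>3 + \<theta>inf) (- \<theta>2) * F0 (- \<theta>1) (- \<theta>1 + \<theta>3 - \<theta>inf) * F0 \<theta>1 \<theta>2
      / (8 * (0 - 1) * (1 - 0) * \<eta> * (X0 - \<eta>))"
    unfolding Q'_def[abs_def] by (intro tendsto_intros F xt yt X Y) (use \<eta>nz in auto)
  \<comment> \<open>\<open>qform\<close> as a function of the four kinds of products, to be evaluated on both sides.\<close>
  define C where "C P R S S' = (1 - ((\<theta>2 - \<theta>1) / \<sigma>)^2) * (P - R) - 2 * (\<theta>2 - \<theta>1) / \<sigma>^2 * (S + S')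
      + 2 / \<sigma> * (S - S')" for P R S S' :: complex
  have C: "(\<lambda>n. C (P n) (R n) (S n) (S' n)) \<longlonglongrightarrow> C p r s s'"
    if "P \<longlonglongrightarrow> p" "R \<longlonglongrightarrow> r" "S \<longlonglongrightarrow> s" "S' \<longlonglongrightarrow> s'" for P R S S' p r s s'
    unfolding C_def by (intro tendsto_add tendsto_diff tendsto_mult tendsto_const that)
  have signs: "8 * (0 - 1) * (1 - 0) * \<eta> * (X0 - \<eta>) = 8 * \<eta> * (\<eta> - X0)"
    "8 * (0 - 1) * (1 - 0) * \<eta> * (\<eta> - X0) = - (8 * \<eta> * (\<eta> - X0))" "4 * (0 - 1) * (0 - 1) * \<eta> = 4 * \<eta>"
    "4 * (1 - 0) * (X0 - \<eta>) = 4 * (X0 - \<eta>)"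
    by (simp_all add: algebra_simps)
  have "(\<lambda>n. C (P13 n) (P23 n) (Q n) (Q' n)) \<longlonglongrightarrow> (\<theta>inf + \<theta>3 - \<sigma>) * (\<theta>inf - \<theta>3 - \<sigma>) * J"
    using C[OF P13 P23 Q Q'] alg(2)[of \<theta>3 \<theta>inf] unfolding signs C_def by simp
  moreover have "\<forall>\<^sub>F n in sequentially. C (P13 n) (P23 n) (Q n) (Q' n) = X n * qform \<sigma> (\<Phi>s n) (outer_block (\<Phi>s n))"
    using good diag[of 1] diag[of 2]
  proof eventually_elim
    case (elim n)
    have dd: "\<Phi>s n $ 1 $ 1 - \<Phi>s n $ 2 $ 2 = \<theta>2 - \<theta>1"
      using elim(2,3) by (simp add: diag3_def)
    have e: "P13 n = X n * (\<Phi>s n$1$3 * \<Phi>s n$3$1)" "P23 n = X n * (\<Phi>s n$2$3 * \<Phi>s n$3$2)"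
      "Q n = X n * (\<Phi>s n$1$3 * \<Phi>s n$3$2 * \<Phi>s n$2$1)" "Q' n = X n * (\<Phi>s n$2$3 * \<Phi>s n$3$1 * \<Phi>s n$1$2)"
      unfolding P13_def P23_def Q_def Q'_def using prods(2-5)[of n, symmetric] elim(1) x0 Xnz by blast+
    show ?case
      unfolding e qform_outer_block dd C_def by (simp add: algebra_simps)
  qed
  ultimately have "(\<lambda>n. X n * qform \<sigma> (\<Phi>s n) (outer_block (\<Phi>s n))) \<longlonglongrightarrow> (\<theta>inf + \<theta>3 - \<sigma>) * (\<theta>inf - \<theta>3 - \<sigma>) * J"
    by (rule Lim_transform_eventually)
  from LIMSEQ_unique[OF q1 this] have q2: "qform \<sigma> A (outer_block A) = (\<theta>inf + \<theta>3 - \<sigma>) * (\<theta>inf - \<theta>3 - \<sigma>) * J" .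

  define c1 c2 where "c1 = (\<theta>inf - \<theta>1 - \<theta>2 - \<theta>3) / 2" and "c2 = (- \<theta>inf - \<theta>1 - \<theta>2 - \<theta>3) / 2"
  have dist: "distinct [0, c1, c2]" using assms(15) by (simp add: in_PVI_class_def c1_def c2_def)
  \<comment> \<open>The conjugated matrices converge to \<open>A\<close> and inherit the characteristic polynomial of \<open>\<Phi>\<close>.\<close>
  have inv: "\<forall>\<^sub>F n in sequentially. det (conj_pow (l n) (delta_part 2 A) (\<Phi>s n)) = 0 \<and>
      minors2 (conj_pow (l n) (delta_part 2 A) (\<Phi>s n)) = c1 * c2"
    using cls
  proof eventually_elim
    case (elim n)
    then have "eigenvals (\<Phi>s n) = {0, c1, c2}" by (simp add: c1_def c2_def)
    with charpoly_of_eigenvals[OF this dist]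
      invariants_of_charpoly[OF conj_pow_charpoly[OF spectral_block[OF \<sigma> \<sigma>2], of "l n" "\<Phi>s n"]]
    show ?case by simp
  qed
  have detA: "det A = 0"
  proof -
    have "\<forall>\<^sub>F n in sequentially. det (conj_pow (l n) (delta_part 2 A) (\<Phi>s n)) = 0"
      using inv by eventually_elim simp
    from LIMSEQ_unique[OF tendsto_det_minors2(1)[OF lim2] tendsto_eventually[OF this]] show ?thesis .
  qed
  have minA: "minors2 A = c1 * c2"
  proof -
    have "\<forall>\<^sub>F n in sequentially. minors2 (conj_pow (l n) (delta_part 2 A) (\<Phi>s n)) = c1 * c2"
      using inv by eventually_elim simp
    from LIMSEQ_unique[OF tendsto_det_minors2(2)[OF lim2] tendsto_eventually[OF this]] show ?thesis .
  qed
  define p12 p13 p23 q q' where "p12 = A$1$2 * A$2$1" and "p13 = A$1$3 * A$3$1" and "p23 = A$2$3 * A$3$2"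
    and "q = A$1$3 * A$3$2 * A$2$1" and "q' = A$2$3 * A$3$1 * A$1$2"
  note p_defs = p12_def p13_def p23_def q_def q'_def
  have \<theta>inf: "\<theta>inf^2 = 4 * (p12 + p23 + p13) + \<theta>1^2 + \<theta>2^2 + \<theta>3^2 - 2 * (\<theta>1 * \<theta>2 + \<theta>2 * \<theta>3 + \<theta>1 * \<theta>3)"
    using minA unfolding minors2_def d c1_def c2_def p_defs[symmetric]
    by (simp add: field_simps power2_eq_square)
  have det: "q + q' = \<theta>1 * \<theta>2 * \<theta>3 - \<theta>1 * p23 - \<theta>2 * p13 - \<theta>3 * p12"
    using detA unfolding det_3 d p_defs by (simp add: algebra_simps)
  have s2: "\<sigma>^2 = (\<theta>1 - \<theta>2)^2 + 4 * p12"
    using p12 unfolding p_defs by (simp add: algebra_simps)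
  have main: "(\<theta>inf + \<theta>3 - \<sigma>) * (\<theta>inf - \<theta>3 - \<sigma>) * J = (p13 - p23) + (\<theta>1 - \<theta>2) * (\<theta>1 + \<theta>2 - 2 * \<theta>3) / 4
      + 2 / \<sigma> * (q - q') + (\<theta>1^2 - \<theta>2^2) * (\<theta>3^2 - \<theta>inf^2) / (4 * \<sigma>^2)"
    using q2 qform_J_identity[OF \<sigma> s2 det \<theta>inf] unfolding qform_outer_block d p_defs[symmetric] by simp
  have \<phi>d: "\<phi> 1 1 = - \<theta>1" "\<phi> 2 2 = - \<theta>2" "\<phi> 3 3 = - \<theta>3"
    unfolding assms(3) pr(1) d by simp_all
  have \<phi>p: "\<phi> 1 2 * \<phi> 2 1 = p12" "\<phi> 1 3 * \<phi> 3 1 = p13" "\<phi> 3 1 * \<phi> 1 3 = p13" "\<phi> 2 3 * \<phi> 3 2 = p23"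
    "\<phi> 3 2 * \<phi> 2 3 = p23" "\<phi> 1 3 * \<phi> 3 2 * \<phi> 2 1 = q" "\<phi> 2 3 * \<phi> 3 1 * \<phi> 1 2 = q'"
    unfolding assms(3) pr(2,3) p_defs by simp_all
  have \<phi>12: "4 * \<phi> 1 2 * \<phi> 2 1 = 4 * p12" by (simp only: mult.assoc \<phi>p)
  have signs': "- \<theta>1 - - \<theta>2 = - (\<theta>1 - \<theta>2)" "- \<theta>2 - - \<theta>1 = \<theta>1 - \<theta>2"
    "2 * - \<theta>3 - - \<theta>1 - - \<theta>2 = \<theta>1 + \<theta>2 - 2 * \<theta>3"
    by simp_all
  show ?thesis
    unfolding \<phi>12 \<phi>p \<phi>d signs' minus_minus power2_minus
    by (intro conjI refl s2 \<theta>inf main)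
qed

end
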